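(* Let $\mu\in(0,\infty)$ be a fixed number and let $T\sim F_T$, $B\sim F_B$, $\Lambda\sim F_\Lambda$ be nonnegative random variables. Then, for an arbitrary constant $a>0$, we have $$0\le \mathsf{E}[T]<1,\quad \mathsf{E}[\Lambda]=1/a,\quad \mathsf{E}[\Lambda^2]<\infty\quad\text{and}\quad 0\le \mathsf{E}[B]<\infty$$ if and only if the functional equation $$\hat F(s)=\int_0^\infty(1+\lambda\,\sigma_B(\sigma(s)))^{-a}\,\mathrm{d}F_\Lambda(\lambda),\quad s\ge 0,$$ has exactly one solution $X\sim F$ (a distribution $F$ of a nonnegative random variable $X$) with mean $\mu$ and finite variance. Moreover, in this case, $$\mathsf{Var}[X]=\frac{a^2\,\mathsf{Var}[\Lambda]+a\,\mathsf{E}[\Lambda^2]+\mathsf{E}[B]+\mathsf{E}[T]}{1-\mathsf{E}[T]}\,\mu^2 .$$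
   Context: For a nonnegative random variable $Y$, $Y\sim F_Y$ means that $Y$ has distribution function $F_Y$, and $\hat F_Y(s)=\mathsf{E}[e^{-sY}]=\int_0^\infty e^{-sy}\,\mathrm{d}F_Y(y)$, $s\ge0$, is its Laplace–Stieltjes transform. Integrals $\int_0^\infty$ with respect to distributions include a possible atom at $0$. For a distribution $F$ on $[0,\infty)$ with mean $\mu\in(0,\infty)$ (the unknown of the equation), define $$\sigma(s)=\int_0^\infty\frac{1-\hat F(ts)}{t}\,\mathrm{d}F_T(t),\quad s\ge0,$$ where the integrand at $t=0$ is defined by continuity to be $\mu s$. Equivalently, $\sigma(s)=\mu\int_0^s\hat F_{TZ}(x)\,\mathrm{d}x$, where $Z$ is independent of $T$ and has the length-biased distribution $F_Z(z)=\frac1\mu\int_0^z x\,\mathrm{d}F(x)$, $z\ge0$. Note that $\sigma$ depends on the unknown $F$. Define also $\sigma_B(s)=\int_0^s\hat F_B(t)\,\mathrm{d}t$, $s\ge0$. *)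

theory Defs
  imports "HOL-Probability.Probability"
begin

text \<open>
  The statement only involves the laws of the random variables, so these are represented by
  their distributions, i.e. Borel probability measures on the real line concentrated on the
  nonnegative reals (with a possible atom at 0).
\<close>

definition nonneg_distribution :: "real measure \<Rightarrow> bool" where
  "nonneg_distribution F \<longleftrightarrow> real_distribution F \<and> (AE x in F. 0 \<le> x)"

text \<open>
  Moments that may be infinite take values in the extended nonnegative reals: a Bochner integral
  would silently be 0 in the non-integrable case. Their real-valued counterparts \<open>mean\<close> and
  \<open>var\<close> are only meaningful if the moments are finite.
\<close>

definition emoment :: "nat \<Rightarrow> real measure \<Rightarrow> ennreal" where
  "emoment k F = (\<integral>\<^sup>+x. ennreal (x ^ k) \<partial>F)"

abbreviation emean :: "real measure \<Rightarrow> ennreal" where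
  "emean F \<equiv> emoment 1 F"

definition mean :: "real measure \<Rightarrow> real" where
  "mean F = (LINT x|F. x)"

definition evar :: "real measure \<Rightarrow> ennreal" where
  "evar F = (\<integral>\<^sup>+x. ennreal ((x - mean F)\<^sup>2) \<partial>F)"

definition var :: "real measure \<Rightarrow> real" where
  "var F = (LINT x|F. (x - mean F)\<^sup>2)"

definition LS_transform :: "real measure \<Rightarrow> real \<Rightarrow> real" where
  "LS_transform F s = (LINT x|F. exp (- s * x))"

text \<open>
  The value \<open>\<mu> * s\<close> at \<open>t = 0\<close> is the continuous extension of the integrand if \<open>F\<close> has mean \<open>\<mu>\<close>.
\<close>

definition sigma :: "real \<Rightarrow> real measure \<Rightarrow> real measure \<Rightarrow> real \<Rightarrow> real" where
  "sigma \<mu> F\<^sub>T F s =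
     (LINT t|F\<^sub>T. (if t = 0 then \<mu> * s else (1 - LS_transform F (t * s)) / t))"

definition sigma_B :: "real measure \<Rightarrow> real \<Rightarrow> real" where
  "sigma_B F\<^sub>B s = (LBINT t:{0..s}. LS_transform F\<^sub>B t)"

definition solves_equation ::
  "real \<Rightarrow> real \<Rightarrow> real measure \<Rightarrow> real measure \<Rightarrow> real measure \<Rightarrow> real measure \<Rightarrow> bool" where
  "solves_equation \<mu> a F\<^sub>T F\<^sub>B F\<^sub>\<Lambda> F \<longleftrightarrow>
     (\<forall>s\<ge>0. LS_transform F s =
        (LINT l|F\<^sub>\<Lambda>. (1 + l * sigma_B F\<^sub>B (sigma \<mu> F\<^sub>T F s)) powr (- a)))"

definition is_solution ::
  "real \<Rightarrow> real \<Rightarrow> real measure \<Rightarrow> real measure \<Rightarrow> real measure \<Rightarrow> real measure \<Rightarrow> bool" where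
  "is_solution \<mu> a F\<^sub>T F\<^sub>B F\<^sub>\<Lambda> F \<longleftrightarrow>
     nonneg_distribution F \<and> emean F = ennreal \<mu> \<and> evar F < \<infinity> \<and>
     solves_equation \<mu> a F\<^sub>T F\<^sub>B F\<^sub>\<Lambda> F"

end

theory Submission
  imports Defs "HOL-Real_Asymp.Real_Asymp"
begin

text \<open>
  Everything is decided by the behaviour of both sides of the equation at \<open>s = 0\<close> up to order \<open>s\<^sup>2\<close>.

  \<^emph>\<open>Necessity.\<close> Let \<open>F\<close> be a solution with mean \<open>\<mu>\<close> and finite second moment \<open>m2\<close>, and let
  \<open>u = \<sigma>(s)\<close>, \<open>v = \<sigma>\<^sub>B(u)\<close>. At first order \<open>u\<close> and \<open>v\<close> behave like \<open>\<mu> s\<close>, and the right-hand side like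
  \<open>1 - a E[\<Lambda>] v\<close>, so \<open>E[\<Lambda>] = 1 / a\<close>. At second order the remainder of the transform
  splits into the nonnegative remainders \<open>\<mu> s - u\<close>, \<open>u - v\<close> and \<open>E[(1 + \<Lambda> v)\<^sup>-\<^sup>a] - 1 + v\<close>. After
  division by \<open>s\<^sup>2\<close> they converge, possibly to infinity, and the limits give
  \<open>m2 = m2 E[T] + \<mu>\<^sup>2 E[B] + \<mu>\<^sup>2 a (a + 1) E[\<Lambda>\<^sup>2]\<close>. As \<open>m2\<close> is finite and positive, all moments on the
  right are finite and \<open>E[T] < 1\<close>; solving for \<open>m2\<close> yields the variance
  (\<open>solution_moment_identities\<close>, \<open>solution_imp_moments\<close>).

  \<^emph>\<open>Uniqueness.\<close> Under the moment conditions, the right-hand side contracts the distance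
  \<open>sup |f(s) - g(s)| / s\<^sup>2\<close> of transforms with the common mean \<open>\<mu>\<close> by the factor \<open>E[T]\<close>
  (\<open>equation_rhs_contraction\<close>). This distance is finite for two solutions, hence zero, and a distribution on the
  half-line is determined by its transform (\<open>LS_transform_unique\<close>).

  \<^emph>\<open>Existence.\<close> The iteration starts at the point mass at \<open>\<mu>\<close> and stays in the band
  \<open>1 - \<mu> s \<le> f(s) \<le> 1 - \<mu> s + m2 s\<^sup>2 / 2\<close>, with \<open>m2\<close> the solution of the identity above. Its limit is a
  transform by the continuity theorem (\<open>is_LS_transform_limit\<close>), and the band determines its mean and bounds its second
  moment (\<open>solution_exists\<close>). The remaining point is that the right-hand side is
  again a transform (\<open>equation_rhs_is_LS_transform\<close>). Transforms are closed under products, mixtures and limits.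
  Therefore \<open>(1 + l c (1 - f))\<^sup>-\<^sup>a\<close> is a transform, being a negative binomial mixture of powers of \<open>f\<close>; and
  \<open>\<sigma>\<close>, then \<open>exp (- b \<sigma>)\<close>, then \<open>\<sigma>\<^sub>B \<circ> \<sigma>\<close> are handled by writing \<open>\<sigma>\<close> and \<open>\<sigma>\<^sub>B \<circ> \<sigma>\<close> as limits of
  functions \<open>c (1 - f)\<close>.
\<close>

section \<open>Elementary bounds on the exponential and on negative powers\<close>

lemma exp_neg_ge: "1 - x \<le> exp (- x)" for x :: real
  using exp_ge_add_one_self[of "-x"] by simp

lemma exp_neg_le_quadratic:
  fixes x :: real
  assumes "0 \<le> x"
  shows "exp (- x) \<le> 1 - x + x\<^sup>2 / 2"
proof -
  have "1 - 0 + 0\<^sup>2 / 2 - exp (- 0) \<le> 1 - x + x\<^sup>2 / 2 - exp (- x)"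
  proof (rule DERIV_nonneg_imp_nondecreasing[OF assms])
    fix y :: real
    assume "0 \<le> y"
    show "\<exists>z. ((\<lambda>x. 1 - x + x\<^sup>2 / 2 - exp (- x)) has_real_derivative z) (at y) \<and> 0 \<le> z"
      by (rule exI[of _ "y - 1 + exp (- y)"]) (use exp_neg_ge[of y] in \<open>auto intro!: derivative_eq_intros\<close>)
  qed
  then show ?thesis by simp
qed

lemma powr_neg_ge_linear:
  fixes y a :: real
  assumes "0 \<le> y" "0 \<le> a"
  shows "1 - a * y \<le> (1 + y) powr (- a)"
proof -
  have "a * ln (1 + y) \<le> a * y"
    using assms ln_add_one_self_le_self[of y] by (intro mult_left_mono) auto
  then have "1 - a * y \<le> 1 - a * ln (1 + y)" by simp
  also have "\<dots> \<le> (1 + y) powr (- a)"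
    using exp_neg_ge[of "a * ln (1 + y)"] assms by (simp add: powr_def)
  finally show ?thesis .
qed

text \<open>
  The difference of the two sides vanishes at \<open>0\<close>, and its derivative is \<open>a\<close> times the gap in the linear bound for
  the exponent \<open>a + 1\<close>.
\<close>

lemma powr_neg_le_quadratic:
  fixes y a :: real
  assumes y: "0 \<le> y" and a: "0 \<le> a"
  shows "(1 + y) powr (- a) \<le> 1 - a * y + a * (a + 1) / 2 * y\<^sup>2"
proof -
  have "1 - a * 0 + a * (a + 1) / 2 * 0\<^sup>2 - (1 + 0) powr (- a)
    \<le> 1 - a * y + a * (a + 1) / 2 * y\<^sup>2 - (1 + y) powr (- a)"
  proof (rule DERIV_nonneg_imp_nondecreasing[OF y])
    fix x :: real
    assume x: "0 \<le> x"
    have "- (a + 1) = - a - 1" by simp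
    then have "0 \<le> a * ((1 + x) powr (- a - 1) - (1 - (a + 1) * x))"
      using powr_neg_ge_linear[of x "a + 1"] x a by (intro mult_nonneg_nonneg) auto
    then show "\<exists>z. ((\<lambda>x. 1 - a * x + a * (a + 1) / 2 * x\<^sup>2 - (1 + x) powr (- a))
        has_real_derivative z) (at x) \<and> 0 \<le> z"
      using x DERIV_fun_powr[of "\<lambda>x. 1 + x" 1 x "- a"]
      by (intro exI[of _ "a * ((1 + x) powr (- a - 1) - (1 - (a + 1) * x))"] conjI)
        (auto intro!: derivative_eq_intros simp: field_simps)
  qed
  then show ?thesis by simp
qed

lemma powr_neg_le_one: "(1 + y) powr (- a) \<le> 1" if "0 \<le> y" "0 \<le> a" for y a :: real
  using that powr_mono[of "-a" 0 "1 + y"] by simp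

text \<open>
  Factoring out the larger of the two powers reduces the estimate to the linear bound at \<open>(y - x) / (1 + x)\<close>.
\<close>

lemma powr_neg_Lipschitz:
  fixes x y a :: real
  assumes "0 \<le> x" "0 \<le> y" "0 \<le> a"
  shows "\<bar>(1 + x) powr (- a) - (1 + y) powr (- a)\<bar> \<le> a * \<bar>x - y\<bar>"
proof -
  have *: "\<bar>(1 + x) powr (- a) - (1 + y) powr (- a)\<bar> \<le> a * (y - x)" if "0 \<le> x" "x \<le> y" for x y
  proof -
    let ?z = "(y - x) / (1 + x)"
    have z: "0 \<le> ?z" "?z \<le> y - x"
      using that by (auto simp: divide_simps mult_left_mono mult_le_cancel_left1)
    have "1 + y = (1 + x) * (1 + ?z)" using that by (simp add: field_simps)
    then have eq: "(1 + y) powr (- a) = (1 + x) powr (- a) * (1 + ?z) powr (- a)"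
      using that z by (metis powr_mult)
    have p: "0 \<le> 1 - (1 + ?z) powr (- a)" "1 - (1 + ?z) powr (- a) \<le> a * ?z"
      using powr_neg_le_one[OF z(1) assms(3)] powr_neg_ge_linear[OF z(1) assms(3)] by auto
    have "(1 + x) powr (- a) - (1 + y) powr (- a) = (1 + x) powr (- a) * (1 - (1 + ?z) powr (- a))"
      unfolding eq by (simp add: algebra_simps)
    moreover have "\<dots> \<le> 1 * (a * ?z)"
      using p powr_neg_le_one[OF that(1) assms(3)] by (intro mult_mono) auto
    moreover have "a * ?z \<le> a * (y - x)" using z assms by (intro mult_left_mono) auto
    moreover have "0 \<le> (1 + x) powr (- a) * (1 - (1 + ?z) powr (- a))" using p by simp
    ultimately show ?thesis by linarith
  qed
  show ?thesis
    using *[of x y] *[of y x] assms by (cases "x \<le> y") (auto simp: abs_minus_commute)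
qed

section \<open>Integration over a distribution on the half-line\<close>

lemma nonneg_distribution_props:
  assumes "nonneg_distribution F"
  shows "prob_space F" "sets F = sets borel" "space F = UNIV" "AE x in F. 0 \<le> x"
    "finite_measure F" "sigma_finite_measure F" "measure F UNIV = 1" "real_distribution F"
proof -
  show r: "real_distribution F" and "AE x in F. 0 \<le> x"
    using assms by (auto simp: nonneg_distribution_def)
  interpret real_distribution F by fact
  show "prob_space F" "sets F = sets borel" "space F = UNIV"
    "finite_measure F" "sigma_finite_measure F" "measure F UNIV = 1"
    using prob_space by (auto simp: prob_space_axioms finite_measure_axioms sigma_finite_measure_axioms)
qed

lemma nonneg_distribution_measurable:
  "nonneg_distribution F \<Longrightarrow> f \<in> borel_measurable borel \<Longrightarrow> f \<in> borel_measurable F"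
  using nonneg_distribution_props(2) measurable_cong_sets by blast

lemma nonneg_distribution_integrable:
  fixes f :: "real \<Rightarrow> real"
  assumes F: "nonneg_distribution F" and f: "f \<in> borel_measurable borel"
    and b: "\<And>x. 0 \<le> x \<Longrightarrow> \<bar>f x\<bar> \<le> B"
  shows "integrable F f"
proof -
  interpret finite_measure F using nonneg_distribution_props[OF F] by simp
  show ?thesis
    by (rule integrable_const_bound[of _ B])
      (use nonneg_distribution_props(4)[OF F] b nonneg_distribution_measurable[OF F f] in auto)
qed

lemma nonneg_distribution_integral_mono:
  fixes f :: "real \<Rightarrow> real"
  assumes F: "nonneg_distribution F" and "integrable F f" "integrable F g"
    and b: "\<And>x. 0 \<le> x \<Longrightarrow> f x \<le> g x"
  shows "(LINT x|F. f x) \<le> (LINT x|F. g x)"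
  by (rule integral_mono_AE) (use nonneg_distribution_props(4)[OF F] assms in auto)

lemma nonneg_distribution_integral_nonneg:
  fixes f :: "real \<Rightarrow> real"
  assumes F: "nonneg_distribution F" and b: "\<And>x. 0 \<le> x \<Longrightarrow> 0 \<le> f x"
  shows "0 \<le> (LINT x|F. f x)"
  by (rule integral_nonneg_AE) (use nonneg_distribution_props(4)[OF F] assms in auto)

lemma nonneg_distribution_integral_le_const:
  fixes f :: "real \<Rightarrow> real"
  assumes F: "nonneg_distribution F" and b: "\<And>x. 0 \<le> x \<Longrightarrow> f x \<le> B" and B: "0 \<le> B"
  shows "(LINT x|F. f x) \<le> B"
proof (cases "integrable F f")
  case True
  interpret prob_space F using nonneg_distribution_props[OF F] by simp
  have "(LINT x|F. f x) \<le> (LINT x|F. B)"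
    by (rule nonneg_distribution_integral_mono[OF F True]) (use b in auto)
  then show ?thesis by (simp add: prob_space)
next
  case False
  then show ?thesis using B by (simp add: not_integrable_integral_eq)
qed

lemma nonneg_distribution_integral_diff_le:
  fixes f g h :: "real \<Rightarrow> real"
  assumes F: "nonneg_distribution F" and f: "integrable F f" and g: "integrable F g"
    and h: "integrable F h" and b: "\<And>x. 0 \<le> x \<Longrightarrow> \<bar>f x - g x\<bar> \<le> h x"
  shows "\<bar>(LINT x|F. f x) - (LINT x|F. g x)\<bar> \<le> (LINT x|F. h x)"
proof -
  have "\<bar>LINT x|F. f x - g x\<bar> \<le> (LINT x|F. \<bar>f x - g x\<bar>)"
    by (rule integral_abs_bound)
  also have "\<dots> \<le> (LINT x|F. h x)"
    by (rule nonneg_distribution_integral_mono[OF F _ h]) (use f g b in auto)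
  finally show ?thesis using f g by simp
qed

lemma nonneg_distribution_integral_cong:
  fixes f :: "real \<Rightarrow> real"
  assumes F: "nonneg_distribution F" and "f \<in> borel_measurable borel" "g \<in> borel_measurable borel"
    and b: "\<And>x. 0 \<le> x \<Longrightarrow> f x = g x"
  shows "(LINT x|F. f x) = (LINT x|F. g x)"
  by (rule integral_cong_AE)
    (use nonneg_distribution_props(4)[OF F] assms nonneg_distribution_measurable[OF F] in auto)

lemma emoment_eq_integral:
  assumes F: "nonneg_distribution F" and "emoment k F < \<infinity>"
  shows "integrable F (\<lambda>x. x ^ k)" "emoment k F = ennreal (LINT x|F. x ^ k)"
proof -
  have m: "(\<lambda>x::real. x ^ k) \<in> borel_measurable F"
    by (rule nonneg_distribution_measurable[OF F]) simp
  have AE: "AE x in F. 0 \<le> x ^ k"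
    using nonneg_distribution_props(4)[OF F] by eventually_elim simp
  show i: "integrable F (\<lambda>x. x ^ k)"
    using assms m AE by (intro integrableI_nonneg) (auto simp: emoment_def)
  show "emoment k F = ennreal (LINT x|F. x ^ k)"
    unfolding emoment_def by (rule nn_integral_eq_integral[OF i AE])
qed

lemma emean_eq_ennreal:
  assumes F: "nonneg_distribution F" and "emean F = ennreal m" and "0 \<le> m"
  shows "integrable F (\<lambda>x. x)" "(LINT x|F. x) = m"
proof -
  show "integrable F (\<lambda>x. x)" using emoment_eq_integral(1)[OF F, of 1] assms by simp
  have "0 \<le> (LINT x|F. x)" by (rule nonneg_distribution_integral_nonneg[OF F]) 
  moreover have "ennreal m = ennreal (LINT x|F. x)"
    using emoment_eq_integral(2)[OF F, of 1] assms by simp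
  ultimately show "(LINT x|F. x) = m" using assms(3) by (metis ennreal_inj)
qed

section \<open>Moments as limits of rescaled integrals\<close>

text \<open>
  Every first and second order expansion below is an instance of this lemma: \<open>q\<close> is a difference quotient
  of the function being expanded and \<open>c\<close> its limit at the origin. As the integrand never exceeds its
  pointwise limit, Fatou's lemma gives convergence in the extended reals, so that the limit is
  identified before the moment is known to be finite.
\<close>

lemma scaled_moment_limit:
  fixes q :: "real \<Rightarrow> real"
  assumes F: "nonneg_distribution F" and q[measurable]: "q \<in> borel_measurable borel"
    and bounds: "\<And>x. 0 < x \<Longrightarrow> 0 \<le> q x \<and> q x \<le> c" and lim: "(q \<longlongrightarrow> c) (at_right 0)"
    and zero: "k = 0 \<Longrightarrow> q 0 = c" and c: "0 \<le> c"
    and s: "s \<longlonglongrightarrow> 0" "\<And>n. 0 < s n"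
  shows "(\<lambda>n. \<integral>\<^sup>+x. ennreal (x ^ k * q (s n * x)) \<partial>F) \<longlonglongrightarrow> ennreal c * emoment k F"
proof -
  note [measurable] = nonneg_distribution_measurable[OF F]
  have meas: "f \<in> borel_measurable F" if "f \<in> borel_measurable borel" for f :: "real \<Rightarrow> ennreal"
    using nonneg_distribution_props(2)[OF F] measurable_cong_sets that by blast
  have m1: "(\<lambda>x. ennreal (x ^ k * q (s n * x))) \<in> borel_measurable F" for n
    by (rule meas) measurable
  have m2: "(\<lambda>x. ennreal c * ennreal (x ^ k)) \<in> borel_measurable F"
    by (rule meas) measurable
  have L: "ennreal c * emoment k F = (\<integral>\<^sup>+x. ennreal c * ennreal (x ^ k) \<partial>F)"
    unfolding emoment_def by (rule nn_integral_cmult[symmetric], rule meas) measurable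
  have pt: "(\<lambda>n. ennreal (x ^ k * q (s n * x))) \<longlonglongrightarrow> ennreal c * ennreal (x ^ k)" if "0 \<le> x" for x
  proof -
    have "(\<lambda>n. x ^ k * q (s n * x)) \<longlonglongrightarrow> x ^ k * c"
    proof (cases "x = 0")
      case True
      then show ?thesis using zero by (cases "k = 0") (auto simp: zero_power)
    next
      case False
      have "filterlim (\<lambda>n. s n * x) (at_right 0) sequentially"
        using s False that s(2)[THEN less_imp_neq] by (auto simp: filterlim_at intro!: tendsto_eq_intros eventuallyI)
      from filterlim_compose[OF lim this] show ?thesis by (intro tendsto_intros)
    qed
    then show ?thesis using c that by (simp add: ennreal_mult[symmetric] mult.commute)
  qed
  have ub: "ennreal (x ^ k * q (s n * x)) \<le> ennreal c * ennreal (x ^ k)" if "0 \<le> x" for x n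
  proof -
    have "x ^ k * q (s n * x) \<le> x ^ k * c"
    proof (cases "x = 0")
      case True
      then show ?thesis using zero by (cases "k = 0") (auto simp: zero_power)
    next
      case False
      then show ?thesis using that bounds[of "s n * x"] s(2)[of n] by (intro mult_left_mono) auto
    qed
    then show ?thesis using c that by (simp add: ennreal_mult[symmetric] mult.commute ennreal_leI)
  qed
  have AE: "AE x in F. 0 \<le> x" by (rule nonneg_distribution_props(4)[OF F])
  have "(\<integral>\<^sup>+x. ennreal c * ennreal (x ^ k) \<partial>F)
      = (\<integral>\<^sup>+x. liminf (\<lambda>n. ennreal (x ^ k * q (s n * x))) \<partial>F)"
    by (rule nn_integral_cong_AE, rule AE_mp[OF AE], rule AE_I2)
      (simp add: lim_imp_Liminf[OF _ pt])
  also have "\<dots> \<le> liminf (\<lambda>n. \<integral>\<^sup>+x. ennreal (x ^ k * q (s n * x)) \<partial>F)"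
    by (rule nn_integral_liminf[OF m1])
  finally have low: "ennreal c * emoment k F \<le> \<dots>" unfolding L .
  have "(\<integral>\<^sup>+x. ennreal (x ^ k * q (s n * x)) \<partial>F) \<le> ennreal c * emoment k F" for n
    unfolding L by (rule nn_integral_mono_AE, rule AE_mp[OF AE], rule AE_I2) (simp add: ub)
  then have "limsup (\<lambda>n. \<integral>\<^sup>+x. ennreal (x ^ k * q (s n * x)) \<partial>F) \<le> ennreal c * emoment k F"
    by (intro Limsup_bounded) auto
  with low show ?thesis
    using Liminf_le_Limsup[of sequentially "\<lambda>n. \<integral>\<^sup>+x. ennreal (x ^ k * q (s n * x)) \<partial>F"]
    by (intro Liminf_eq_Limsup) (auto intro: antisym order_trans)
qed

section \<open>Laplace--Stieltjes transforms and their uniqueness\<close>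

lemma LS_transform_integrable:
  assumes F: "nonneg_distribution F" and "0 \<le> s"
  shows "integrable F (\<lambda>x. exp (- s * x))"
  by (rule nonneg_distribution_integrable[OF F, of _ 1]) (use assms in auto)

lemma LS_transform_bounds:
  assumes F: "nonneg_distribution F" and s: "0 \<le> s"
  shows "0 \<le> LS_transform F s" "LS_transform F s \<le> 1"
  unfolding LS_transform_def
  using s by (auto intro!: nonneg_distribution_integral_nonneg[OF F] nonneg_distribution_integral_le_const[OF F])

lemma LS_transform_measurable:
  assumes F: "nonneg_distribution F"
  shows "LS_transform F \<in> borel_measurable borel"
proof -
  interpret sigma_finite_measure F using nonneg_distribution_props[OF F] by simp
  note [measurable_cong] = nonneg_distribution_props(2)[OF F]
  show ?thesis unfolding LS_transform_def by measurable
qed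

lemma nonneg_distribution_integral_const:
  assumes F: "nonneg_distribution F"
  shows "(LINT x|F. c) = (c :: real)"
  using nonneg_distribution_props[OF F] by simp

lemma LS_transform_0: "nonneg_distribution F \<Longrightarrow> LS_transform F 0 = 1"
  using nonneg_distribution_integral_const[of F 1] by (simp add: LS_transform_def)

lemma LS_transform_antimono:
  assumes F: "nonneg_distribution F" and "0 \<le> s" "s \<le> t"
  shows "LS_transform F t \<le> LS_transform F s"
  unfolding LS_transform_def
  by (rule nonneg_distribution_integral_mono[OF F])
    (use assms LS_transform_integrable[OF F] in \<open>auto intro: mult_right_mono\<close>)

lemma abs_exp_neg_diff_le:
  fixes x y :: real
  assumes "0 \<le> x" "0 \<le> y"
  shows "\<bar>exp (- x) - exp (- y)\<bar> \<le> \<bar>x - y\<bar>"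
proof -
  have "exp (- x) - exp (- y) \<le> y - x" if "0 \<le> x" "x \<le> y" for x y :: real
  proof -
    have "exp (- x) - exp (- y) = exp (- x) * (1 - exp (- (y - x)))"
      by (simp add: algebra_simps exp_add[symmetric])
    also have "\<dots> \<le> 1 * (y - x)"
      using that exp_neg_ge[of "y - x"] by (intro mult_mono) auto
    finally show ?thesis by simp
  qed
  from this[of x y] this[of y x] show ?thesis using assms
    by (cases "x \<le> y") auto
qed

lemma LS_transform_Lipschitz:
  assumes F: "nonneg_distribution F" and m: "emean F = ennreal m" "0 \<le> m"
    and "0 \<le> s" "0 \<le> t"
  shows "\<bar>LS_transform F s - LS_transform F t\<bar> \<le> m * \<bar>s - t\<bar>"
proof -
  note mean = emean_eq_ennreal[OF F m]
  have "\<bar>LS_transform F s - LS_transform F t\<bar> \<le> (LINT x|F. x * \<bar>s - t\<bar>)"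
    unfolding LS_transform_def
  proof (rule nonneg_distribution_integral_diff_le[OF F])
    fix x :: real assume x: "0 \<le> x"
    have "\<bar>exp (- (s * x)) - exp (- (t * x))\<bar> \<le> \<bar>s * x - t * x\<bar>"
      using assms x by (intro abs_exp_neg_diff_le) auto
    also have "\<dots> = x * \<bar>s - t\<bar>"
      using x by (simp add: left_diff_distrib[symmetric] abs_mult)
    finally show "\<bar>exp (- s * x) - exp (- t * x)\<bar> \<le> x * \<bar>s - t\<bar>" by simp
  qed (use mean LS_transform_integrable[OF F] assms in auto)
  then show ?thesis using mean by simp
qed

lemma LS_transform_ge_linear:
  assumes F: "nonneg_distribution F" and m: "emean F = ennreal m" "0 \<le> m" and s: "0 \<le> s"
  shows "1 - m * s \<le> LS_transform F s"
  using LS_transform_Lipschitz[OF F m s, of 0] LS_transform_0[OF F] s by simp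

text \<open>
  The substitution \<open>y = exp (- x)\<close> turns the values of the transform at the natural numbers into the
  moments of a law on the unit interval, and these determine the integrals of all continuous functions by the
  Weierstrass theorem.
\<close>

lemma LS_transform_eq_imp_integral_eq:
  fixes h :: "real \<Rightarrow> real"
  assumes F: "nonneg_distribution F" and G: "nonneg_distribution G"
    and eq: "\<And>s. 0 \<le> s \<Longrightarrow> LS_transform F s = LS_transform G s"
    and h: "continuous_on {0..1} h" and hm: "h \<in> borel_measurable borel"
  shows "(LINT x|F. h (exp (- x))) = (LINT x|G. h (exp (- x)))"
proof -
  have poly: "integrable H (\<lambda>x. \<Sum>i\<le>n. a i * exp (- x) ^ i)"
      "(LINT x|H. (\<Sum>i\<le>n. a i * exp (- x) ^ i)) = (\<Sum>i\<le>n. a i * LS_transform H i)"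
    if H: "nonneg_distribution H" for H and a :: "nat \<Rightarrow> real" and n
  proof -
    have i: "integrable H (\<lambda>x. exp (- x) ^ i)" for i
      using LS_transform_integrable[OF H, of "real i"] by (simp add: exp_of_nat_mult[symmetric])
    then show "integrable H (\<lambda>x. \<Sum>i\<le>n. a i * exp (- x) ^ i)" by auto
    show "(LINT x|H. (\<Sum>i\<le>n. a i * exp (- x) ^ i)) = (\<Sum>i\<le>n. a i * LS_transform H i)"
      using i by (simp add: LS_transform_def exp_of_nat_mult[symmetric])
  qed
  obtain B where B: "\<And>y. y \<in> {0..1} \<Longrightarrow> \<bar>h y\<bar> \<le> B"
    using compact_imp_bounded[OF compact_continuous_image[OF h]]
    unfolding bounded_iff by (auto simp del: atLeastAtMost_iff)
  have hi: "integrable H (\<lambda>x. h (exp (- x)))" if "nonneg_distribution H" for H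
    by (rule nonneg_distribution_integrable[OF that _ B]) (use hm in auto)
  have "\<bar>(LINT x|F. h (exp (- x))) - (LINT x|G. h (exp (- x)))\<bar> \<le> e" if e: "0 < e" for e
  proof -
    obtain g where g: "real_polynomial_function g" "\<And>y. y \<in> {0..1} \<Longrightarrow> \<bar>h y - g y\<bar> < e / 2"
      using Stone_Weierstrass_real_polynomial_function[OF _ h, of "e / 2"] e by auto
    then obtain a n where an: "g = (\<lambda>y. \<Sum>i\<le>n. a i * y ^ i)"
      unfolding real_polynomial_function_iff_sum by blast
    have *: "\<bar>(LINT x|H. h (exp (- x))) - (LINT x|H. g (exp (- x)))\<bar> \<le> e / 2"
      if H: "nonneg_distribution H" for H
    proof -
      have "\<bar>(LINT x|H. h (exp (- x))) - (LINT x|H. g (exp (- x)))\<bar> \<le> (LINT x|H. e / 2)"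
      proof (rule nonneg_distribution_integral_diff_le[OF H hi[OF H]])
        show "integrable H (\<lambda>x. g (exp (- x)))" unfolding an by (rule poly(1)[OF H])
        show "integrable H (\<lambda>x. e / 2)"
          by (rule nonneg_distribution_integrable[OF H, of _ "\<bar>e / 2\<bar>"]) auto
        show "\<bar>h (exp (- x)) - g (exp (- x))\<bar> \<le> e / 2" if "0 \<le> x" for x
          using less_imp_le[OF g(2)[of "exp (- x)"]] that by simp
      qed
      then show ?thesis by (simp only: nonneg_distribution_integral_const[OF H])
    qed
    have "(LINT x|F. g (exp (- x))) = (LINT x|G. g (exp (- x)))"
      by (simp add: an poly(2)[OF F] poly(2)[OF G] eq)
    with *[OF F] *[OF G] show ?thesis by linarith
  qed
  from field_le_epsilon[of _ 0, simplified, OF this] show ?thesis by simp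
qed

text \<open>
  Continuous ramps in \<open>exp (- x)\<close> decrease to the indicator of \<open>{..c}\<close>, hence the distribution functions agree.
\<close>

theorem LS_transform_unique:
  assumes F: "nonneg_distribution F" and G: "nonneg_distribution G"
    and eq: "\<And>s. 0 \<le> s \<Longrightarrow> LS_transform F s = LS_transform G s"
  shows "F = G"
proof (rule cdf_unique)
  show "real_distribution F" "real_distribution G"
    using nonneg_distribution_props(8) F G by auto
  define h where "h c n y = max 0 (min 1 (1 + real n * (y - exp (- c))))" for c n and y :: real
  have hc: "continuous_on UNIV (h c n)" for c n
    unfolding h_def by (intro continuous_intros)
  have hm[measurable]: "h c n \<in> borel_measurable borel" for c n
    using hc by (rule borel_measurable_continuous_onI)
  have conv: "(\<lambda>n. LINT x|H. h c n (exp (- x))) \<longlonglongrightarrow> cdf H c" if H: "nonneg_distribution H" for H c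
  proof -
    interpret prob_space H using nonneg_distribution_props[OF H] by simp
    note [measurable_cong] = nonneg_distribution_props(2)[OF H]
    have lim: "(\<lambda>n. h c n (exp (- x))) \<longlonglongrightarrow> indicator {..c} x" for x
    proof (cases "x \<le> c")
      case True
      then show ?thesis by (auto simp: h_def)
    next
      case False
      define d where "d = exp (- x) - exp (- c)"
      have "d < 0" using False by (simp add: d_def)
      have "filterlim (\<lambda>n. 1 + real n * d) at_bot sequentially"
        using \<open>d < 0\<close> by real_asymp
      then have "\<forall>\<^sub>F n in sequentially. 1 + real n * d \<le> 0"
        by (auto simp: filterlim_at_bot)
      then have "(\<lambda>n. max 0 (min 1 (1 + real n * d))) \<longlonglongrightarrow> 0"
        by (rule tendsto_eventually[OF eventually_mono]) simp
      then have "(\<lambda>n. max 0 (min 1 (1 + real n * (exp (- x) - exp (- c))))) \<longlonglongrightarrow> 0"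
        by (simp add: d_def)
      then show ?thesis using False by (simp add: h_def)
    qed
    have "(\<lambda>n. LINT x|H. h c n (exp (- x))) \<longlonglongrightarrow> (LINT x|H. indicator {..c} x)"
    proof (rule integral_dominated_convergence[where w = "\<lambda>_. 1"])
      show "AE x in H. (\<lambda>n. h c n (exp (- x))) \<longlonglongrightarrow> indicator {..c} x" using lim by auto
    qed (auto simp: h_def)
    then show ?thesis
      using nonneg_distribution_props(3)[OF H] by (simp add: cdf_def)
  qed
  show "cdf F = cdf G"
  proof
    fix c
    have "(LINT x|F. h c n (exp (- x))) = (LINT x|G. h c n (exp (- x)))" for n
      by (rule LS_transform_eq_imp_integral_eq[OF F G eq])
        (auto intro: continuous_on_subset[OF hc])
    with conv[OF F, of c] conv[OF G, of c] show "cdf F c = cdf G c"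
      by (auto intro: LIMSEQ_unique)
  qed
qed

section \<open>Expansion of the transform at the origin\<close>

lemma nonneg_distribution_nn_integral:
  fixes f :: "real \<Rightarrow> real"
  assumes F: "nonneg_distribution F" and i: "integrable F f"
    and nn: "\<And>x. 0 \<le> x \<Longrightarrow> 0 \<le> f x"
  shows "ennreal (LINT x|F. f x) = (\<integral>\<^sup>+x. ennreal (f x) \<partial>F)"
proof -
  have "AE x in F. 0 \<le> f x"
    using nonneg_distribution_props(4)[OF F] by eventually_elim (rule nn)
  then show ?thesis using nn_integral_eq_integral[OF i] by simp
qed

lemma nonneg_distribution_nn_integral_cong:
  fixes f :: "real \<Rightarrow> ennreal"
  assumes F: "nonneg_distribution F" and "\<And>x. 0 \<le> x \<Longrightarrow> f x = g x"
  shows "(\<integral>\<^sup>+x. f x \<partial>F) = (\<integral>\<^sup>+x. g x \<partial>F)"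
  by (rule nn_integral_cong_AE, rule AE_mp[OF nonneg_distribution_props(4)[OF F]], rule AE_I2)
    (simp add: assms)

text \<open>
  The limit is taken in the extended nonnegative reals, so this also decides whether the mean is finite.
\<close>

lemma LS_transform_first_order:
  assumes F: "nonneg_distribution F" and s: "s \<longlonglongrightarrow> 0" "\<And>n. 0 < s n"
  shows "(\<lambda>n. ennreal ((1 - LS_transform F (s n)) / s n)) \<longlonglongrightarrow> emean F"
proof -
  let ?q = "\<lambda>x::real. (1 - exp (- x)) / x"
  have "(\<lambda>n. \<integral>\<^sup>+x. ennreal (x ^ 1 * ?q (s n * x)) \<partial>F) \<longlonglongrightarrow> ennreal 1 * emean F"
  proof (rule scaled_moment_limit[OF F _ _ _ _ _ s])
    show "0 \<le> ?q x \<and> ?q x \<le> 1" if "0 < x" for x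
      using exp_neg_ge[of x] that by (simp add: field_simps)
    show "(?q \<longlongrightarrow> 1) (at_right 0)" by real_asymp
  qed auto
  moreover have "(\<integral>\<^sup>+x. ennreal (x ^ 1 * ?q (s n * x)) \<partial>F)
      = ennreal ((1 - LS_transform F (s n)) / s n)" for n
  proof -
    have i: "integrable F (\<lambda>x. exp (- s n * x))"
      by (rule LS_transform_integrable[OF F]) (simp add: less_imp_le s)
    have one: "integrable F (\<lambda>x. 1::real)"
      by (rule nonneg_distribution_integrable[OF F, of _ 1]) auto
    have i2: "integrable F (\<lambda>x. (1 - exp (- s n * x)) / s n)"
      using i one by (intro integrable_divide Bochner_Integration.integrable_diff)
    have "(\<integral>\<^sup>+x. ennreal (x ^ 1 * ?q (s n * x)) \<partial>F)
        = (\<integral>\<^sup>+x. ennreal ((1 - exp (- s n * x)) / s n) \<partial>F)"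
    proof (rule nonneg_distribution_nn_integral_cong[OF F])
      show "ennreal (x ^ 1 * ?q (s n * x)) = ennreal ((1 - exp (- s n * x)) / s n)" for x
        using s(2)[of n] by (cases "x = 0") auto
    qed
    also have "\<dots> = ennreal (LINT x|F. (1 - exp (- s n * x)) / s n)"
      using s(2)[of n] by (intro nonneg_distribution_nn_integral[OF F i2, symmetric]) auto
    also have "(LINT x|F. (1 - exp (- s n * x)) / s n) = (1 - LS_transform F (s n)) / s n"
      using i one nonneg_distribution_integral_const[OF F, of 1] by (simp add: LS_transform_def)
    finally show ?thesis .
  qed
  ultimately show ?thesis by simp
qed

lemma LS_transform_remainder_nn_integral:
  assumes F: "nonneg_distribution F" and m: "emean F = ennreal m" "0 \<le> m" and s: "0 < s"
  shows "ennreal ((LS_transform F s - 1 + m * s) / s\<^sup>2)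
    = (\<integral>\<^sup>+x. ennreal (x\<^sup>2 * ((exp (- (s * x)) - 1 + s * x) / (s * x)\<^sup>2)) \<partial>F)"
proof -
  note mean = emean_eq_ennreal[OF F m]
  have i: "integrable F (\<lambda>x. exp (- s * x))"
    by (rule LS_transform_integrable[OF F]) (simp add: less_imp_le s)
  have one: "integrable F (\<lambda>x. 1::real)"
    by (rule nonneg_distribution_integrable[OF F, of _ 1]) auto
  have sx: "integrable F (\<lambda>x. s * x)" using mean by simp
  have i2: "integrable F (\<lambda>x. (exp (- s * x) - 1 + s * x) / s\<^sup>2)"
    using i one sx by (intro integrable_divide Bochner_Integration.integrable_diff Bochner_Integration.integrable_add)
  have "(LINT x|F. (exp (- s * x) - 1 + s * x) / s\<^sup>2) = (LS_transform F s - 1 + m * s) / s\<^sup>2"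
    using i one sx mean nonneg_distribution_integral_const[OF F, of 1] by (simp add: LS_transform_def mult.commute)
  note A = this
  have nn: "0 \<le> (exp (- s * x) - 1 + s * x) / s\<^sup>2" for x
    using exp_neg_ge[of "s * x"] by simp
  have "ennreal ((LS_transform F s - 1 + m * s) / s\<^sup>2)
      = (\<integral>\<^sup>+x. ennreal ((exp (- s * x) - 1 + s * x) / s\<^sup>2) \<partial>F)"
    unfolding A[symmetric] by (rule nonneg_distribution_nn_integral[OF F i2 nn])
  also have "\<dots> = (\<integral>\<^sup>+x. ennreal (x\<^sup>2 * ((exp (- (s * x)) - 1 + s * x) / (s * x)\<^sup>2)) \<partial>F)"
    by (rule nonneg_distribution_nn_integral_cong[OF F])
      (use s in \<open>auto simp: power2_eq_square divide_simps\<close>)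
  finally show ?thesis .
qed

lemma LS_transform_second_order:
  assumes F: "nonneg_distribution F" and m: "emean F = ennreal m" "0 \<le> m"
    and s: "s \<longlonglongrightarrow> 0" "\<And>n. 0 < s n"
  shows "(\<lambda>n. ennreal ((LS_transform F (s n) - 1 + m * s n) / (s n)\<^sup>2))
    \<longlonglongrightarrow> ennreal (1 / 2) * emoment 2 F"
proof -
  let ?q = "\<lambda>x::real. (exp (- x) - 1 + x) / x\<^sup>2"
  have "(\<lambda>n. \<integral>\<^sup>+x. ennreal (x ^ 2 * ?q (s n * x)) \<partial>F) \<longlonglongrightarrow> ennreal (1 / 2) * emoment 2 F"
  proof (rule scaled_moment_limit[OF F _ _ _ _ _ s])
    show "0 \<le> ?q x \<and> ?q x \<le> 1 / 2" if "0 < x" for x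
      using exp_neg_ge[of x] exp_neg_le_quadratic[of x] that by (simp add: field_simps)
    show "(?q \<longlongrightarrow> 1 / 2) (at_right 0)" by real_asymp
  qed auto
  then show ?thesis using LS_transform_remainder_nn_integral[OF F m s(2)] by simp
qed

lemma LS_transform_le_quadratic:
  assumes F: "nonneg_distribution F" and m: "emean F = ennreal m" "0 \<le> m"
    and m2: "emoment 2 F = ennreal m2" "0 \<le> m2" and s: "0 \<le> s"
  shows "LS_transform F s \<le> 1 - m * s + m2 / 2 * s\<^sup>2"
proof -
  note mean = emean_eq_ennreal[OF F m]
  have sq: "integrable F (\<lambda>x. x\<^sup>2)" "(LINT x|F. x\<^sup>2) = m2"
    using emoment_eq_integral[OF F, of 2] m2 nonneg_distribution_integral_nonneg[OF F, of "\<lambda>x. x\<^sup>2"]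
    by auto
  have one: "integrable F (\<lambda>x. 1::real)"
    by (rule nonneg_distribution_integrable[OF F, of _ 1]) auto
  have i: "integrable F (\<lambda>x. 1 - s * x + s\<^sup>2 / 2 * x\<^sup>2)"
    using mean sq one by auto
  have "LS_transform F s \<le> (LINT x|F. 1 - s * x + s\<^sup>2 / 2 * x\<^sup>2)"
    unfolding LS_transform_def
  proof (rule nonneg_distribution_integral_mono[OF F LS_transform_integrable[OF F s] i])
    show "exp (- s * x) \<le> 1 - s * x + s\<^sup>2 / 2 * x\<^sup>2" if "0 \<le> x" for x
      using exp_neg_le_quadratic[of "s * x"] s that by (simp add: power_mult_distrib)
  qed
  also have "\<dots> = 1 - m * s + m2 / 2 * s\<^sup>2"
    using mean sq one nonneg_distribution_integral_const[OF F, of 1] by (simp add: mult.commute)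
  finally show ?thesis .
qed

section \<open>The functionals sigma and sigma-B\<close>

text \<open>
  The integrand of \<open>sigma\<close>: the slope of the chord of the transform over \<open>[0, t * s]\<close>, up to sign and the factor \<open>s\<close>.
\<close>

definition chord :: "real \<Rightarrow> real measure \<Rightarrow> real \<Rightarrow> real \<Rightarrow> real" where
  "chord m F s t = (if t = 0 then m * s else (1 - LS_transform F (t * s)) / t)"

lemma sigma_eq_integral_chord: "sigma m \<nu> F s = (LINT t|\<nu>. chord m F s t)"
  by (simp add: sigma_def chord_def)

lemma chord_measurable:
  assumes "nonneg_distribution F"
  shows "chord m F s \<in> borel_measurable borel"
proof -
  note [measurable] = LS_transform_measurable[OF assms]
  show ?thesis unfolding chord_def[abs_def] by measurable
qed

context
  fixes F :: "real measure" and m :: real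
  assumes F: "nonneg_distribution F" and m: "emean F = ennreal m" "0 \<le> m"
begin

lemma chord_bounds:
  assumes "0 \<le> s" "0 \<le> t"
  shows "0 \<le> chord m F s t" "chord m F s t \<le> m * s"
  using assms LS_transform_bounds[OF F, of "t * s"] LS_transform_ge_linear[OF F m, of "t * s"] m(2)
  by (auto simp: chord_def divide_simps algebra_simps)

lemma chord_integrable:
  assumes \<nu>: "nonneg_distribution \<nu>" and "0 \<le> s"
  shows "integrable \<nu> (chord m F s)"
  by (rule nonneg_distribution_integrable[OF \<nu> chord_measurable[OF F], where B = "m * s"])
    (use chord_bounds assms in auto)

lemma sigma_bounds:
  assumes \<nu>: "nonneg_distribution \<nu>" and s: "0 \<le> s"
  shows "0 \<le> sigma m \<nu> F s" "sigma m \<nu> F s \<le> m * s"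
  unfolding sigma_eq_integral_chord
  using chord_bounds[OF s] s m
  by (auto intro!: nonneg_distribution_integral_nonneg[OF \<nu>] nonneg_distribution_integral_le_const[OF \<nu>])

lemma sigma_Lipschitz:
  assumes \<nu>: "nonneg_distribution \<nu>" and s: "0 \<le> s" "0 \<le> u"
  shows "\<bar>sigma m \<nu> F s - sigma m \<nu> F u\<bar> \<le> m * \<bar>s - u\<bar>"
proof -
  have "\<bar>sigma m \<nu> F s - sigma m \<nu> F u\<bar> \<le> (LINT t|\<nu>. m * \<bar>s - u\<bar>)"
    unfolding sigma_eq_integral_chord
  proof (rule nonneg_distribution_integral_diff_le[OF \<nu> chord_integrable[OF \<nu> s(1)] chord_integrable[OF \<nu> s(2)]])
    show "integrable \<nu> (\<lambda>t. m * \<bar>s - u\<bar>)"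
      by (rule nonneg_distribution_integrable[OF \<nu>, of _ "m * \<bar>s - u\<bar>"]) (use m in auto)
    fix t :: real assume t: "0 \<le> t"
    show "\<bar>chord m F s t - chord m F u t\<bar> \<le> m * \<bar>s - u\<bar>"
    proof (cases "t = 0")
      case True
      then show ?thesis using m(2) by (simp add: chord_def right_diff_distrib[symmetric] abs_mult)
    next
      case False
      with t have t: "0 < t" by simp
      have "\<bar>LS_transform F (t * s) - LS_transform F (t * u)\<bar> \<le> m * \<bar>t * s - t * u\<bar>"
        using t s by (intro LS_transform_Lipschitz[OF F m]) auto
      also have "m * \<bar>t * s - t * u\<bar> = m * \<bar>s - u\<bar> * t"
        using t by (simp add: right_diff_distrib[symmetric] abs_mult)
      finally have "\<bar>LS_transform F (t * s) - LS_transform F (t * u)\<bar> / t \<le> m * \<bar>s - u\<bar>"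
        using t by (simp add: pos_divide_le_eq)
      moreover have "\<bar>chord m F s t - chord m F u t\<bar>
          = \<bar>LS_transform F (t * s) - LS_transform F (t * u)\<bar> / t"
        using t by (simp add: chord_def diff_divide_distrib[symmetric] abs_minus_commute)
      ultimately show ?thesis by simp
    qed
  qed
  then show ?thesis by (simp only: nonneg_distribution_integral_const[OF \<nu>])
qed

lemma chord_ge:
  assumes q: "\<And>s. 0 \<le> s \<Longrightarrow> LS_transform F s \<le> 1 - m * s + M / 2 * s\<^sup>2"
    and s: "0 \<le> s" and t: "0 \<le> t"
  shows "m * s - M / 2 * s\<^sup>2 * t \<le> chord m F s t"
proof (cases "t = 0")
  case False
  with t have "0 < t" by simp
  then show ?thesis using q[of "t * s"] s
    by (simp add: chord_def field_simps power2_eq_square)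
qed (simp add: chord_def)

lemma sigma_ge:
  assumes q: "\<And>s. 0 \<le> s \<Longrightarrow> LS_transform F s \<le> 1 - m * s + M / 2 * s\<^sup>2"
    and \<nu>: "nonneg_distribution \<nu>" and e: "emean \<nu> = ennreal e" "0 \<le> e" and s: "0 \<le> s"
  shows "m * s - M / 2 * s\<^sup>2 * e \<le> sigma m \<nu> F s"
proof -
  note mean = emean_eq_ennreal[OF \<nu> e]
  have one: "integrable \<nu> (\<lambda>t. m * s)"
    by (rule nonneg_distribution_integrable[OF \<nu>, of _ "\<bar>m * s\<bar>"]) auto
  have lin: "integrable \<nu> (\<lambda>t. M / 2 * s\<^sup>2 * t)" using mean by auto
  have "m * s - M / 2 * s\<^sup>2 * e = (LINT t|\<nu>. m * s - M / 2 * s\<^sup>2 * t)"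
    using mean one lin nonneg_distribution_integral_const[OF \<nu>, of "m * s"] by simp
  also have "\<dots> \<le> sigma m \<nu> F s"
    unfolding sigma_eq_integral_chord
    by (rule nonneg_distribution_integral_mono[OF \<nu> _ chord_integrable[OF \<nu> s]])
      (use one lin chord_ge[OF q s] in auto)
  finally show ?thesis .
qed

lemma sigma_first_order:
  assumes \<nu>: "nonneg_distribution \<nu>" and s: "s \<longlonglongrightarrow> 0" "\<And>n. 0 < s n"
  shows "(\<lambda>n. sigma m \<nu> F (s n) / s n) \<longlonglongrightarrow> m"
proof -
  let ?q = "\<lambda>x. if x = 0 then m else (1 - LS_transform F x) / x"
  note [measurable] = LS_transform_measurable[OF F]
  have "(\<lambda>n. \<integral>\<^sup>+t. ennreal (t ^ 0 * ?q (s n * t)) \<partial>\<nu>) \<longlonglongrightarrow> ennreal m * emoment 0 \<nu>"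
  proof (rule scaled_moment_limit[OF \<nu> _ _ _ _ _ s])
    show b: "0 \<le> ?q x \<and> ?q x \<le> m" if "0 < x" for x
      using chord_bounds[of 1 x] that by (simp add: chord_def)
    show "(?q \<longlongrightarrow> m) (at_right 0)"
    proof (rule tendsto_at_right_sequentially[of 0 1])
      fix S :: "nat \<Rightarrow> real" assume S: "\<And>n. 0 < S n" "S \<longlonglongrightarrow> 0"
      have "(\<lambda>n. (1 - LS_transform F (S n)) / S n) \<longlonglongrightarrow> m"
        by (rule tendsto_ennrealD[OF LS_transform_first_order[OF F S(2,1), unfolded m]])
          (use m b S in \<open>auto intro!: always_eventually dest: less_imp_neq\<close>)
      then show "(\<lambda>n. ?q (S n)) \<longlonglongrightarrow> m" using S(1)[THEN less_imp_neq] by simp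
    qed auto
  qed (use m in auto)
  moreover have "emoment 0 \<nu> = 1"
    using nonneg_distribution_props(3)[OF \<nu>] prob_space.emeasure_space_1[OF nonneg_distribution_props(1)[OF \<nu>]]
    by (simp add: emoment_def)
  moreover have "(\<integral>\<^sup>+t. ennreal (t ^ 0 * ?q (s n * t)) \<partial>\<nu>) = ennreal (sigma m \<nu> F (s n) / s n)" for n
  proof -
    have "(\<integral>\<^sup>+t. ennreal (t ^ 0 * ?q (s n * t)) \<partial>\<nu>) = (\<integral>\<^sup>+t. ennreal (chord m F (s n) t / s n) \<partial>\<nu>)"
      by (rule nn_integral_cong) (use s(2)[of n] in \<open>auto simp: chord_def mult.commute\<close>)
    also have "\<dots> = ennreal (LINT t|\<nu>. chord m F (s n) t / s n)"
      by (rule nonneg_distribution_nn_integral[OF \<nu>, symmetric])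
        (use s(2)[of n] chord_integrable[OF \<nu>, of "s n"] chord_bounds in auto)
    finally show ?thesis by (simp add: sigma_eq_integral_chord)
  qed
  ultimately have "(\<lambda>n. ennreal (sigma m \<nu> F (s n) / s n)) \<longlonglongrightarrow> ennreal m" by simp
  then show ?thesis
    by (rule tendsto_ennrealD) (use m s(2) sigma_bounds[OF \<nu>] in \<open>auto intro!: always_eventually divide_nonneg_pos simp: less_imp_le\<close>)
qed

text \<open>
  The remainder of \<open>sigma\<close> is the integral of \<open>t\<close> times the normalised second order remainder of the
  transform at \<open>s * t\<close>. Normalising gains a factor \<open>t\<^sup>2\<close> against the single \<open>t\<close> in the denominator, which
  is why only the first moment of \<open>\<nu>\<close> appears.
\<close>

lemma sigma_second_order:
  assumes m2: "emoment 2 F = ennreal m2" "0 \<le> m2"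
    and \<nu>: "nonneg_distribution \<nu>" and s: "s \<longlonglongrightarrow> 0" "\<And>n. 0 < s n"
  shows "(\<lambda>n. ennreal ((m * s n - sigma m \<nu> F (s n)) / (s n)\<^sup>2)) \<longlonglongrightarrow> ennreal (m2 / 2) * emean \<nu>"
proof -
  let ?q = "\<lambda>x. (LS_transform F x - 1 + m * x) / x\<^sup>2"
  note [measurable] = LS_transform_measurable[OF F]
  have "(\<lambda>n. \<integral>\<^sup>+t. ennreal (t ^ 1 * ?q (s n * t)) \<partial>\<nu>) \<longlonglongrightarrow> ennreal (m2 / 2) * emean \<nu>"
  proof (rule scaled_moment_limit[OF \<nu> _ _ _ _ _ s])
    show b: "0 \<le> ?q x \<and> ?q x \<le> m2 / 2" if "0 < x" for x
      using LS_transform_le_quadratic[OF F m m2, of x] LS_transform_ge_linear[OF F m, of x] that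
      by (simp add: field_simps)
    show "(?q \<longlongrightarrow> m2 / 2) (at_right 0)"
    proof (rule tendsto_at_right_sequentially[of 0 1])
      fix S :: "nat \<Rightarrow> real" assume S: "\<And>n. 0 < S n" "S \<longlonglongrightarrow> 0"
      have "ennreal (1 / 2) * emoment 2 F = ennreal (m2 / 2)"
        unfolding m2(1) by (subst ennreal_mult[symmetric]) (use m2 in auto)
      then have *: "(\<lambda>n. ennreal (?q (S n))) \<longlonglongrightarrow> ennreal (m2 / 2)"
        using LS_transform_second_order[OF F m S(2,1)] by simp
      show "(\<lambda>n. ?q (S n)) \<longlonglongrightarrow> m2 / 2"
        by (rule tendsto_ennrealD[OF *]) (use m2 b S in \<open>auto intro!: always_eventually\<close>)
    qed auto
  qed (use m2 in auto)
  moreover have "(\<integral>\<^sup>+t. ennreal (t ^ 1 * ?q (s n * t)) \<partial>\<nu>)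
      = ennreal ((m * s n - sigma m \<nu> F (s n)) / (s n)\<^sup>2)" for n
  proof -
    have i: "integrable \<nu> (\<lambda>t. m * s n)"
      by (rule nonneg_distribution_integrable[OF \<nu>, of _ "\<bar>m * s n\<bar>"]) auto
    have c: "integrable \<nu> (chord m F (s n))"
      by (rule chord_integrable[OF \<nu>]) (simp add: s less_imp_le)
    have "(\<integral>\<^sup>+t. ennreal (t ^ 1 * ?q (s n * t)) \<partial>\<nu>)
        = (\<integral>\<^sup>+t. ennreal ((m * s n - chord m F (s n) t) / (s n)\<^sup>2) \<partial>\<nu>)"
    proof (rule nn_integral_cong)
      have "x * ((L - 1 + m * (S * x)) / (S * x)\<^sup>2) = (m * S - (1 - L) / x) / S\<^sup>2"
        if "x \<noteq> 0" "S \<noteq> 0" for L x S :: real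
        using that by (simp add: divide_simps power2_eq_square)
      then show "ennreal (t ^ 1 * ?q (s n * t)) = ennreal ((m * s n - chord m F (s n) t) / (s n)\<^sup>2)" for t
        using s(2)[of n] by (cases "t = 0") (auto simp: chord_def mult.commute)
    qed
    also have "\<dots> = ennreal (LINT t|\<nu>. (m * s n - chord m F (s n) t) / (s n)\<^sup>2)"
      by (rule nonneg_distribution_nn_integral[OF \<nu>, symmetric])
        (use s(2)[of n] i c chord_bounds in auto)
    also have "(LINT t|\<nu>. (m * s n - chord m F (s n) t) / (s n)\<^sup>2)
        = (m * s n - sigma m \<nu> F (s n)) / (s n)\<^sup>2"
      using i c nonneg_distribution_integral_const[OF \<nu>, of "m * s n"] by (simp add: sigma_eq_integral_chord)
    finally show ?thesis .
  qed
  ultimately show ?thesis by simp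
qed

end

text \<open>
  The source of the contraction factor: a difference quadratic in \<open>t * s\<close> is divided by \<open>t\<close>
  and integrated, which leaves \<open>s\<^sup>2\<close> times the mean of \<open>\<nu>\<close>.
\<close>

lemma sigma_diff_le:
  assumes F: "nonneg_distribution F" and mF: "emean F = ennreal m" "0 \<le> m"
    and G: "nonneg_distribution G" and mG: "emean G = ennreal m"
    and \<nu>: "nonneg_distribution \<nu>" and e: "emean \<nu> = ennreal e" "0 \<le> e"
    and diff: "\<And>s. 0 \<le> s \<Longrightarrow> \<bar>LS_transform F s - LS_transform G s\<bar> \<le> C * s\<^sup>2" and s: "0 \<le> s"
  shows "\<bar>sigma m \<nu> F s - sigma m \<nu> G s\<bar> \<le> C * e * s\<^sup>2"
proof -
  note mean = emean_eq_ennreal[OF \<nu> e]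
  have "\<bar>sigma m \<nu> F s - sigma m \<nu> G s\<bar> \<le> (LINT t|\<nu>. C * s\<^sup>2 * t)"
    unfolding sigma_eq_integral_chord
  proof (rule nonneg_distribution_integral_diff_le[OF \<nu> chord_integrable[OF F mF \<nu> s]
        chord_integrable[OF G mG mF(2) \<nu> s]])
    show "integrable \<nu> (\<lambda>t. C * s\<^sup>2 * t)" using mean by simp
    fix t :: real assume t: "0 \<le> t"
    show "\<bar>chord m F s t - chord m G s t\<bar> \<le> C * s\<^sup>2 * t"
    proof (cases "t = 0")
      case False
      with t have t: "0 < t" by simp
      have "\<bar>chord m F s t - chord m G s t\<bar> = \<bar>LS_transform F (t * s) - LS_transform G (t * s)\<bar> / t"
        using t by (simp add: chord_def diff_divide_distrib[symmetric] abs_minus_commute)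
      also have "\<dots> \<le> C * (t * s)\<^sup>2 / t"
        using diff[of "t * s"] t s by (intro divide_right_mono) auto
      also have "\<dots> = C * s\<^sup>2 * t" using t by (simp add: power2_eq_square)
      finally show ?thesis .
    qed (simp add: chord_def)
  qed
  also have "\<dots> = C * e * s\<^sup>2" using mean by simp
  finally show ?thesis .
qed

lemma point_mass:
  fixes x :: real
  assumes "0 \<le> x"
  shows "nonneg_distribution (return borel x)" "LS_transform (return borel x) s = exp (- s * x)"
    "emoment k (return borel x) = ennreal (x ^ k)"
proof -
  interpret prob_space "return borel x" by (rule prob_space_return) simp
  show "nonneg_distribution (return borel x)"
    using assms by (auto simp: nonneg_distribution_def real_distribution_def real_distribution_axioms_def
        prob_space_axioms AE_return)
  show "LS_transform (return borel x) s = exp (- s * x)"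
    unfolding LS_transform_def by (rule integral_return) auto
  show "emoment k (return borel x) = ennreal (x ^ k)"
    unfolding emoment_def by (rule nn_integral_return) auto
qed

text \<open>
  Integrating \<open>exp (- t * b)\<close> over \<open>{0..s}\<close> first shows that \<open>sigma_B\<close> is \<open>sigma\<close> for the unit mass
  at \<open>1\<close>, whose mean is \<open>1\<close>. All facts about \<open>sigma\<close> therefore apply to both functionals.
\<close>

lemma sigma_B_eq_sigma:
  assumes \<nu>: "nonneg_distribution \<nu>" and s: "0 \<le> s"
  shows "sigma_B \<nu> s = sigma 1 \<nu> (return borel 1) s"
proof -
  interpret N: prob_space \<nu> using nonneg_distribution_props[OF \<nu>] by simp
  note [measurable_cong] = nonneg_distribution_props(2)[OF \<nu>]
  interpret P: pair_sigma_finite lborel \<nu> by unfold_locales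
  let ?f = "\<lambda>(t, b). indicator {0..s} t * exp (- t * b) :: real"
  have inner: "(LINT t|lborel. indicator {0..s} t * exp (- t * b)) = chord 1 (return borel 1) s b"
    if "0 \<le> b" for b
  proof -
    have "((\<lambda>t. exp (- t * b)) has_integral (chord 1 (return borel 1) s b)) {0..s}"
    proof (cases "b = 0")
      case True
      then show ?thesis using has_integral_const_real[of "1::real" 0 s] s by (simp add: chord_def)
    next
      case False
      have "((\<lambda>t. exp (- t * b)) has_integral (- exp (- s * b) / b - (- exp (- 0 * b) / b))) {0..s}"
        by (rule fundamental_theorem_of_calculus[OF s])
          (use False in \<open>auto intro!: derivative_eq_intros simp: has_real_derivative_iff_has_vector_derivative[symmetric]\<close>)
      then show ?thesis using False
        by (simp add: chord_def point_mass(2) diff_divide_distrib mult.commute)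
    qed
    moreover have "set_integrable lborel {0..s} (\<lambda>t. exp (- t * b))"
      by (rule borel_integrable_atLeastAtMost') (intro continuous_intros)
    ultimately have "(LINT t:{0..s}|lborel. exp (- t * b)) = chord 1 (return borel 1) s b"
      by (simp add: set_borel_integral_eq_integral integral_unique)
    then show ?thesis by (simp add: set_lebesgue_integral_def)
  qed
  have int: "integrable (lborel \<Otimes>\<^sub>M \<nu>) ?f"
  proof (rule P.Fubini_integrable)
    have le: "(LINT b|\<nu>. norm (?f (t, b))) = indicator {0..s} t * LS_transform \<nu> t" for t
      by (simp add: LS_transform_def abs_mult)
    have "integrable lborel (\<lambda>t. indicator {0..s} t * LS_transform \<nu> t)"
    proof (rule Bochner_Integration.integrable_bound[of _ "\<lambda>t. indicator {0..s} t :: real"])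
      show "integrable lborel (\<lambda>t. indicator {0..s} t :: real)"
        using s by (intro integrable_real_indicator) auto
      show "(\<lambda>t. indicator {0..s} t * LS_transform \<nu> t) \<in> borel_measurable lborel"
        using LS_transform_measurable[OF \<nu>] by simp
    qed (use LS_transform_bounds[OF \<nu>] in \<open>auto simp: indicator_def\<close>)
    then show "integrable lborel (\<lambda>t. LINT b|\<nu>. norm (?f (t, b)))" unfolding le .
    show "AE t in lborel. integrable \<nu> (\<lambda>b. ?f (t, b))"
      using LS_transform_integrable[OF \<nu>] by (auto simp: indicator_def)
  qed measurable
  have "sigma_B \<nu> s = (LINT t|lborel. LINT b|\<nu>. ?f (t, b))"
    by (simp add: sigma_B_def set_lebesgue_integral_def LS_transform_def)
  also have "\<dots> = (LINT b|\<nu>. LINT t|lborel. ?f (t, b))"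
    using P.Fubini_integral[OF int] by simp
  also have "\<dots> = sigma 1 \<nu> (return borel 1) s"
    unfolding sigma_eq_integral_chord
    by (rule nonneg_distribution_integral_cong[OF \<nu>])
      (use inner chord_measurable[OF point_mass(1)] in \<open>auto\<close>)
  finally show ?thesis .
qed

section \<open>The continuity theorem\<close>

definition is_LS_transform :: "(real \<Rightarrow> real) \<Rightarrow> bool" where
  "is_LS_transform f \<longleftrightarrow> (\<exists>F. nonneg_distribution F \<and> (\<forall>s\<ge>0. f s = LS_transform F s))"

lemma is_LS_transformI:
  "nonneg_distribution F \<Longrightarrow> (\<And>s. 0 \<le> s \<Longrightarrow> f s = LS_transform F s) \<Longrightarrow> is_LS_transform f"
  by (auto simp: is_LS_transform_def)

lemma is_LS_transform_cong:
  "is_LS_transform f \<Longrightarrow> (\<And>s. 0 \<le> s \<Longrightarrow> g s = f s) \<Longrightarrow> is_LS_transform g"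
  by (auto simp: is_LS_transform_def)

lemma is_LS_transform_bounds:
  assumes "is_LS_transform f" "0 \<le> s"
  shows "0 \<le> f s" "f s \<le> 1"
  using assms LS_transform_bounds by (auto simp: is_LS_transform_def)

lemma is_LS_transform_exp: "0 \<le> x \<Longrightarrow> is_LS_transform (\<lambda>s. exp (- s * x))"
  by (rule is_LS_transformI[OF point_mass(1)]) (auto simp: point_mass(2))

text \<open>
  This form of the integrand is bounded on the whole line, as the theorems on weak convergence and on the
  Giry monad demand.
\<close>

lemma LS_transform_extend:
  assumes F: "nonneg_distribution F"
  shows "LS_transform F s = (LINT x|F. exp (- s * \<bar>x\<bar>))"
  unfolding LS_transform_def by (rule nonneg_distribution_integral_cong[OF F]) auto

lemma cdf_neg_eq_0:
  assumes F: "nonneg_distribution F" and "c < 0"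
  shows "cdf F c = 0"
proof -
  have "AE x in F. x \<notin> {..c}"
    using nonneg_distribution_props(4)[OF F] by eventually_elim (use assms in auto)
  then have "emeasure F {..c} = 0"
    by (rule AE_iff_measurable[THEN iffD1, rotated -1]) 
      (use nonneg_distribution_props(2,3)[OF F] in auto)
  then show ?thesis by (simp add: cdf_def measure_def)
qed

text \<open>
  A Markov type inequality: \<open>exp (- \<delta> * x)\<close> is at most \<open>exp (- 1)\<close> beyond \<open>1 / \<delta>\<close>.
\<close>

lemma LS_transform_tail:
  assumes F: "nonneg_distribution F" and \<delta>: "0 < \<delta>"
  shows "(1 - exp (- 1)) * (1 - cdf F (1 / \<delta>)) \<le> 1 - LS_transform F \<delta>"
proof -
  interpret prob_space F using nonneg_distribution_props[OF F] by simp
  note [measurable_cong] = nonneg_distribution_props(2)[OF F]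
  let ?I = "indicator {..1 / \<delta>} :: real \<Rightarrow> real"
  have i: "integrable F ?I"
    by (rule nonneg_distribution_integrable[OF F, of _ 1]) (auto simp: indicator_def)
  have one: "integrable F (\<lambda>x. exp (- 1) :: real)"
    by (rule nonneg_distribution_integrable[OF F, of _ "exp (- 1)"]) auto
  have I: "(LINT x|F. ?I x) = cdf F (1 / \<delta>)"
    using nonneg_distribution_props(3)[OF F] by (simp add: cdf_def)
  have "LS_transform F \<delta> \<le> (LINT x|F. exp (- 1) + (1 - exp (- 1)) * ?I x)"
    unfolding LS_transform_def
  proof (rule nonneg_distribution_integral_mono[OF F])
    show "exp (- \<delta> * x) \<le> exp (- 1) + (1 - exp (- 1)) * ?I x" if "0 \<le> x" for x
      using \<delta> that by (auto simp: indicator_def field_simps)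
  qed (use LS_transform_integrable[OF F, of \<delta>] \<delta> one i in auto)
  also have "\<dots> = exp (- 1) + (1 - exp (- 1)) * cdf F (1 / \<delta>)"
    using one i I nonneg_distribution_integral_const[OF F, of "exp (- 1)"] by simp
  finally show ?thesis by (simp add: algebra_simps)
qed

text \<open>
  Continuity of \<open>g\<close> at \<open>0\<close> bounds the tails of almost all \<open>F n\<close> at one common point; the finitely
  many others are tight individually.
\<close>

lemma tight_of_LS_transform_limit:
  assumes F: "\<And>n. nonneg_distribution (F n)"
    and lim: "\<And>s. 0 \<le> s \<Longrightarrow> (\<lambda>n. LS_transform (F n) s) \<longlonglongrightarrow> g s"
    and g: "(g \<longlongrightarrow> 1) (at_right 0)"
  shows "tight F"
  unfolding tight_def
proof (intro conjI allI impI)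
  show rd: "real_distribution (F n)" for n using nonneg_distribution_props(8)[OF F] .
  fix \<epsilon> :: real assume \<epsilon>: "0 < \<epsilon>"
  define c where "c = 1 - exp (- 1 :: real)"
  have c: "0 < c" by (simp add: c_def)
  have "\<forall>\<^sub>F s in at_right 0. dist (g s) 1 < \<epsilon> * c"
    using g \<epsilon> c by (intro tendstoD) auto
  moreover have "\<forall>\<^sub>F s in at_right 0. (0::real) < s" by (rule eventually_at_right_less)
  ultimately have "\<forall>\<^sub>F s in at_right 0. dist (g s) 1 < \<epsilon> * c \<and> 0 < s" by eventually_elim simp
  then obtain \<delta> where \<delta>: "dist (g \<delta>) 1 < \<epsilon> * c" "0 < \<delta>"
    using eventually_happens'[OF trivial_limit_at_right_real] by blast
  then have "1 - \<epsilon> * c < g \<delta>" by (auto simp: dist_real_def)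
  with lim[of \<delta>] \<delta> have "\<forall>\<^sub>F n in sequentially. 1 - \<epsilon> * c < LS_transform (F n) \<delta>"
    by (auto intro: order_tendstoD)
  then obtain N where N: "\<And>n. N \<le> n \<Longrightarrow> 1 - \<epsilon> * c < LS_transform (F n) \<delta>"
    by (auto simp: eventually_sequentially)
  have large: "1 - \<epsilon> < cdf (F n) (1 / \<delta>)" if "N \<le> n" for n
  proof -
    have "c * (1 - cdf (F n) (1 / \<delta>)) < c * \<epsilon>"
      using N[OF that] LS_transform_tail[OF F \<delta>(2), of n, folded c_def]
      by (simp add: mult.commute[of \<epsilon>])
    then show ?thesis using c by simp
  qed
  have "\<exists>K. 1 - \<epsilon> < cdf (F n) K" for n
  proof -
    interpret real_distribution "F n" by (rule rd)
    have "\<forall>\<^sub>F K in at_top. 1 - \<epsilon> < cdf (F n) K"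
      using cdf_lim_at_top_prob \<epsilon> by (intro order_tendstoD) auto
    then show ?thesis by (auto simp: eventually_at_top_linorder)
  qed
  then obtain K where K: "\<And>n. 1 - \<epsilon> < cdf (F n) (K n)" by metis
  define b where "b = Max (insert 0 (insert (1 / \<delta>) (K ` {..<N})))"
  have b: "0 \<le> b" "1 / \<delta> \<le> b" "\<And>n. n < N \<Longrightarrow> K n \<le> b"
    unfolding b_def by (rule Max_ge; auto)+
  have "1 - \<epsilon> < measure (F n) {- 1<..b}" for n
  proof -
    interpret real_distribution "F n" by (rule rd)
    have "1 - \<epsilon> < cdf (F n) b"
    proof (cases "n < N")
      case True
      then show ?thesis using K[of n] cdf_nondecreasing[OF b(3)[OF True]] by simp
    next
      case False
      then show ?thesis using large[of n] cdf_nondecreasing[OF b(2)] by simp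
    qed
    also have "cdf (F n) b = measure (F n) {- 1<..b}"
      using cdf_diff_eq[of "- 1" b] cdf_neg_eq_0[OF F, of "- 1" n] b by simp
    finally show ?thesis .
  qed
  then show "\<exists>a b. a < b \<and> (\<forall>n. 1 - \<epsilon> < measure (F n) {a<..b})"
    using b by (intro exI[of _ "- 1"] exI[of _ b]) auto
qed

text \<open>
  Helly's selection theorem yields a weakly convergent subsequence, and its limit has transform \<open>g\<close> because
  the integrands are bounded and continuous.
\<close>

theorem is_LS_transform_limit:
  assumes f: "\<And>n. is_LS_transform (f n)"
    and lim: "\<And>s. 0 \<le> s \<Longrightarrow> (\<lambda>n. f n s) \<longlonglongrightarrow> g s"
    and g: "(g \<longlongrightarrow> 1) (at_right 0)"
  shows "is_LS_transform g"
proof -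
  from f obtain F where F: "\<And>n. nonneg_distribution (F n)"
    and Ff: "\<And>n s. 0 \<le> s \<Longrightarrow> f n s = LS_transform (F n) s"
    unfolding is_LS_transform_def by metis
  have "tight F"
    by (rule tight_of_LS_transform_limit[OF F _ g]) (use lim Ff in auto)
  from tight_imp_convergent_subsubsequence[OF this strict_mono_id]
  obtain r M where r: "strict_mono r" and M: "real_distribution M" and w: "weak_conv_m (F \<circ> r) M"
    by (auto simp: comp_def)
  have conv: "(\<lambda>n. LINT x|F (r n). \<phi> x) \<longlonglongrightarrow> (LINT x|M. \<phi> x)"
    if "\<And>x. isCont \<phi> x" "\<And>x. \<bar>\<phi> x\<bar> \<le> 1" for \<phi> :: "real \<Rightarrow> real"
    using weak_conv_imp_integral_bdd_continuous_conv[OF _ M w, of \<phi> 1]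
      nonneg_distribution_props(8)[OF F] that by auto
  \<comment> \<open>A continuous test function that vanishes exactly on the half-line shows that no mass of \<open>M\<close> is negative.\<close>
  let ?\<phi> = "\<lambda>x::real. min 1 (max 0 (- x))"
  interpret M: real_distribution M by fact
  have "(LINT x|F (r n). ?\<phi> x) = 0" for n
    using nonneg_distribution_integral_cong[OF F, of ?\<phi> "\<lambda>_. 0" "r n"] by simp
  moreover have "isCont ?\<phi> x" for x by (intro continuous_intros)
  ultimately have zero: "(LINT x|M. ?\<phi> x) = 0"
    using conv[of ?\<phi>] by (simp add: LIMSEQ_const_iff)
  have "integrable M ?\<phi>"
    by (rule M.integrable_const_bound[of _ 1]) auto
  then have "AE x in M. ?\<phi> x = 0"
    using zero by (subst (asm) integral_nonneg_eq_0_iff_AE) auto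
  then have "AE x in M. 0 \<le> x" by eventually_elim (auto simp: min_def max_def split: if_splits)
  then have nd: "nonneg_distribution M" using M by (simp add: nonneg_distribution_def)
  show ?thesis
  proof (rule is_LS_transformI[OF nd])
    fix s :: real assume s: "0 \<le> s"
    have "(\<lambda>n. LINT x|F (r n). exp (- s * \<bar>x\<bar>)) \<longlonglongrightarrow> (LINT x|M. exp (- s * \<bar>x\<bar>))"
      by (rule conv) (use s in \<open>auto intro!: continuous_intros\<close>)
    then have "(\<lambda>n. f (r n) s) \<longlonglongrightarrow> LS_transform M s"
      by (simp add: LS_transform_extend[OF F] LS_transform_extend[OF nd] Ff[OF s])
    moreover have "(\<lambda>n. f (r n) s) \<longlonglongrightarrow> g s"
      using LIMSEQ_subseq_LIMSEQ[OF lim[OF s] r] by (simp add: comp_def)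
    ultimately show "g s = LS_transform M s" by (rule LIMSEQ_unique[symmetric])
  qed
qed

section \<open>Products and mixtures of transforms\<close>

lemma is_LS_transform_scale:
  assumes "is_LS_transform f" "0 \<le> t"
  shows "is_LS_transform (\<lambda>s. f (t * s))"
proof -
  from assms obtain F where F: "nonneg_distribution F"
    and f: "\<And>s. 0 \<le> s \<Longrightarrow> f s = LS_transform F s"
    by (auto simp: is_LS_transform_def)
  interpret prob_space F using nonneg_distribution_props[OF F] by simp
  note [measurable_cong] = nonneg_distribution_props(2)[OF F]
  let ?D = "distr F borel ((*) t)"
  show ?thesis
  proof (rule is_LS_transformI)
    interpret D: prob_space ?D by (rule prob_space_distr) simp
    have "AE x in F. 0 \<le> t * x"
      using nonneg_distribution_props(4)[OF F] by eventually_elim (use assms in auto)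
    then show "nonneg_distribution ?D"
      by (auto simp: nonneg_distribution_def real_distribution_def real_distribution_axioms_def
        D.prob_space_axioms AE_distr_iff)
    show "f (t * s) = LS_transform ?D s" if "0 \<le> s" for s
      using that assms by (simp add: f LS_transform_def integral_distr mult_ac)
  qed
qed

text \<open>
  The transform of a convolution. Adding absolute values makes the sum nonnegative everywhere, not only almost
  everywhere.
\<close>

lemma is_LS_transform_mult:
  assumes "is_LS_transform f" "is_LS_transform g"
  shows "is_LS_transform (\<lambda>s. f s * g s)"
proof -
  from assms obtain F G where F: "nonneg_distribution F" and G: "nonneg_distribution G"
    and f: "\<And>s. 0 \<le> s \<Longrightarrow> f s = LS_transform F s" and g: "\<And>s. 0 \<le> s \<Longrightarrow> g s = LS_transform G s"
    by (auto simp: is_LS_transform_def)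
  interpret F: prob_space F using nonneg_distribution_props[OF F] by simp
  interpret G: prob_space G using nonneg_distribution_props[OF G] by simp
  interpret P: pair_prob_space F G ..
  note [measurable_cong] = nonneg_distribution_props(2)[OF F] nonneg_distribution_props(2)[OF G]
  let ?D = "distr (F \<Otimes>\<^sub>M G) borel (\<lambda>(x, y). \<bar>x\<bar> + \<bar>y\<bar>)"
  show ?thesis
  proof (rule is_LS_transformI)
    interpret D: prob_space ?D by (rule P.prob_space_distr) simp
    show "nonneg_distribution ?D"
      by (auto simp: nonneg_distribution_def real_distribution_def real_distribution_axioms_def
        D.prob_space_axioms AE_distr_iff)
    fix s :: real assume s: "0 \<le> s"
    have "LS_transform ?D s = (LINT z|(F \<Otimes>\<^sub>M G). exp (- s * \<bar>fst z\<bar>) * exp (- s * \<bar>snd z\<bar>))"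
      unfolding LS_transform_def
      by (subst integral_distr)
        (auto simp: case_prod_beta exp_add[symmetric] algebra_simps intro!: Bochner_Integration.integral_cong)
    also have "\<dots> = (LINT x|F. LINT y|G. exp (- s * \<bar>x\<bar>) * exp (- s * \<bar>y\<bar>))"
    proof (subst P.integral_fst'[symmetric])
      have nn: "- (s * \<bar>x\<bar>) \<le> s * \<bar>y\<bar>" for x y
        using mult_nonneg_nonneg[OF s abs_ge_zero[of x]] mult_nonneg_nonneg[OF s abs_ge_zero[of y]]
        by linarith
      show "integrable (F \<Otimes>\<^sub>M G) (\<lambda>z. exp (- s * \<bar>fst z\<bar>) * exp (- s * \<bar>snd z\<bar>))"
        by (rule P.integrable_const_bound[of _ 1]) (use nn in \<open>auto simp: exp_add[symmetric] abs_mult\<close>)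
    qed simp
    also have "\<dots> = LS_transform F s * LS_transform G s"
      by (simp add: LS_transform_extend[OF F] LS_transform_extend[OF G])
    finally show "f s * g s = LS_transform ?D s" by (simp add: f g s)
  qed
qed

lemma is_LS_transform_power:
  assumes "is_LS_transform f"
  shows "is_LS_transform (\<lambda>s. f s ^ k)"
proof (induction k)
  case 0
  show ?case using is_LS_transform_exp[of 0] by simp
next
  case (Suc k)
  then show ?case using is_LS_transform_mult[OF assms] by simp
qed

text \<open>
  Factoring the kernel through the natural numbers makes its measurability automatic; general mixtures are reached
  by discretisation below.
\<close>

lemma is_LS_transform_discrete_mixture:
  fixes K :: "'a \<Rightarrow> nat"
  assumes \<nu>: "prob_space \<nu>" and K[measurable]: "K \<in> \<nu> \<rightarrow>\<^sub>M count_space UNIV"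
    and f: "\<And>k. is_LS_transform (f k)"
  shows "is_LS_transform (\<lambda>s. LINT t|\<nu>. f (K t) s)"
proof -
  from f obtain F where F: "\<And>k. nonneg_distribution (F k)"
    and Ff: "\<And>k s. 0 \<le> s \<Longrightarrow> f k s = LS_transform (F k) s"
    unfolding is_LS_transform_def by metis
  interpret prob_space \<nu> by fact
  have "F \<in> count_space UNIV \<rightarrow>\<^sub>M subprob_algebra borel"
    using nonneg_distribution_props(1,2)[OF F]
    by (auto simp: space_subprob_algebra prob_space_imp_subprob_space)
  then have N: "(\<lambda>t. F (K t)) \<in> \<nu> \<rightarrow>\<^sub>M subprob_algebra borel"
    by (rule measurable_compose[OF K])
  let ?H = "\<nu> \<bind> (\<lambda>t. F (K t))"
  have sets: "sets ?H = sets borel"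
    by (rule sets_bind_measurable[OF N not_empty])
  show ?thesis
  proof (rule is_LS_transformI)
    have "prob_space ?H"
      using nonneg_distribution_props(1)[OF F] by (intro prob_space_bind[OF _ N]) auto
    moreover have "AE x in ?H. 0 \<le> x"
      by (subst AE_bind[OF N]) (use nonneg_distribution_props(4)[OF F] in auto)
    moreover have "space ?H = UNIV" using sets_eq_imp_space_eq[OF sets] by simp
    ultimately show H: "nonneg_distribution ?H"
      by (auto simp: nonneg_distribution_def real_distribution_def real_distribution_axioms_def sets)
    fix s :: real assume s: "0 \<le> s"
    have "LS_transform ?H s = (LINT t|\<nu>. LINT x|F (K t). exp (- s * \<bar>x\<bar>))"
      unfolding LS_transform_extend[OF H]
    proof (rule integral_bind[where K = borel and B = 1 and B' = 1])
      show "AE t in \<nu>. emeasure (F (K t)) (space (F (K t))) \<le> ennreal 1"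
        using nonneg_distribution_props(1)[OF F] by (auto simp: prob_space.emeasure_space_1)
    qed (use N s finite_measure_axioms in auto)
    then show "(LINT t|\<nu>. f (K t) s) = LS_transform ?H s"
      by (simp add: Ff[OF s] LS_transform_extend[OF F])
  qed
qed

lemma is_LS_transform_series:
  fixes w :: "nat \<Rightarrow> real"
  assumes w: "\<And>k. 0 \<le> w k" "w sums 1" and f: "\<And>k. is_LS_transform (f k)"
  shows "is_LS_transform (\<lambda>s. \<Sum>k. w k * f k s)"
proof -
  let ?D = "density (count_space UNIV) (\<lambda>k. ennreal (w k))"
  have "emeasure ?D (space ?D) = 1"
    using w by (simp add: emeasure_density nn_integral_count_space_nat suminf_ennreal_eq sums_unique[OF w(2), symmetric])
  then have "prob_space ?D" by (rule prob_spaceI)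
  from is_LS_transform_discrete_mixture[OF this, of id f] f
  have "is_LS_transform (\<lambda>s. LINT k|?D. f k s)" by (simp add: measurable_density_eq1)
  then show ?thesis
  proof (rule is_LS_transform_cong)
    fix s :: real assume s: "0 \<le> s"
    have "summable (\<lambda>k. norm (w k * f k s))"
      by (rule summable_comparison_test'[of w 0])
        (use w is_LS_transform_bounds[OF f s] in \<open>auto simp: sums_iff mult_left_le\<close>)
    then have "integrable (count_space UNIV) (\<lambda>k. w k * f k s)"
      by (simp add: integrable_count_space_nat_iff)
    from integral_count_space_nat[OF this]
    show "(\<Sum>k. w k * f k s) = (LINT k|?D. f k s)"
      using w by (simp add: integral_real_density)
  qed
qed

lemma is_LS_transform_convex:
  assumes f: "is_LS_transform f" "is_LS_transform g" and p: "0 \<le> p" "p \<le> 1"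
  shows "is_LS_transform (\<lambda>s. p * f s + (1 - p) * g s)"
proof -
  have "is_LS_transform (\<lambda>s. LINT t|measure_pmf (bernoulli_pmf p).
      (if (if t then 0 else 1) = (0::nat) then f else g) s)"
    by (rule is_LS_transform_discrete_mixture) (use f in \<open>auto simp: measure_pmf.prob_space_axioms\<close>)
  then show ?thesis using p by (simp add: mult.commute)
qed

text \<open>
  Together, \<open>grid n (grid_index n t)\<close> is the least positive multiple of \<open>1 / Suc n\<close> strictly above \<open>t\<close>. It is never \<open>0\<close>, so
  that integrands with an exceptional value at \<open>0\<close> are only evaluated at positive points.
\<close>

definition grid :: "nat \<Rightarrow> nat \<Rightarrow> real" where
  "grid n k = real (Suc k) / real (Suc n)"

definition grid_index :: "nat \<Rightarrow> real \<Rightarrow> nat" where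
  "grid_index n t = nat \<lfloor>real (Suc n) * t\<rfloor>"

lemma grid_pos: "0 < grid n k"
  by (simp add: grid_def)

lemma grid_index_measurable[measurable]: "grid_index n \<in> borel \<rightarrow>\<^sub>M count_space UNIV"
  unfolding grid_index_def by measurable

lemma grid_tendsto:
  assumes "0 \<le> t"
  shows "(\<lambda>n. grid n (grid_index n t)) \<longlonglongrightarrow> t"
proof (rule tendsto_sandwich)
  have e: "real (grid_index n t) = of_int \<lfloor>real (Suc n) * t\<rfloor>" for n
    using assms by (simp add: grid_index_def)
  have "t \<le> grid n (grid_index n t) \<and> grid n (grid_index n t) \<le> t + 1 / real (Suc n)" for n
  proof -
    have "real (Suc n) * t \<le> real (grid_index n t) + 1" "real (grid_index n t) \<le> real (Suc n) * t"
      unfolding e by linarith+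
    then show ?thesis by (simp add: grid_def pos_le_divide_eq pos_divide_le_eq algebra_simps)
  qed
  then show "\<forall>\<^sub>F n in sequentially. t \<le> grid n (grid_index n t)"
    "\<forall>\<^sub>F n in sequentially. grid n (grid_index n t) \<le> t + 1 / real (Suc n)" by auto
  show "(\<lambda>n. t + 1 / real (Suc n)) \<longlonglongrightarrow> t" by real_asymp
qed simp

lemma grid_integral_tendsto:
  fixes h :: "real \<Rightarrow> real"
  assumes \<nu>: "nonneg_distribution \<nu>" and hm[measurable]: "h \<in> borel_measurable borel"
    and h: "continuous_on {0..} h" and b: "\<And>t. 0 \<le> t \<Longrightarrow> \<bar>h t\<bar> \<le> B"
  shows "(\<lambda>n. LINT t|\<nu>. h (grid n (grid_index n t))) \<longlonglongrightarrow> (LINT t|\<nu>. h t)"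
proof (rule integral_dominated_convergence[where w = "\<lambda>_. B"])
  note [measurable_cong] = nonneg_distribution_props(2)[OF \<nu>]
  show "h \<in> borel_measurable \<nu>" "(\<lambda>t. h (grid n (grid_index n t))) \<in> borel_measurable \<nu>" for n
    by measurable
  show "integrable \<nu> (\<lambda>_. B)"
    by (rule nonneg_distribution_integrable[OF \<nu>, of _ "\<bar>B\<bar>"]) auto
  show "AE t in \<nu>. (\<lambda>n. h (grid n (grid_index n t))) \<longlonglongrightarrow> h t"
  proof (rule AE_mp[OF nonneg_distribution_props(4)[OF \<nu>]], rule AE_I2, rule impI)
    show "(\<lambda>n. h (grid n (grid_index n t))) \<longlonglongrightarrow> h t" if "0 \<le> t" for t
      by (rule continuous_on_tendsto_compose[OF h grid_tendsto[OF that]])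
        (use that less_imp_le[OF grid_pos] in auto)
  qed
  show "AE t in \<nu>. norm (h (grid n (grid_index n t))) \<le> B" for n
    using b grid_pos[THEN less_imp_le] by auto
qed

text \<open>
  On the grid only countably many of the transforms occur, so the discretised integrals are discrete mixtures; they
  converge to the integral by continuity in \<open>t\<close>.
\<close>

lemma is_LS_transform_mixture:
  assumes \<nu>: "nonneg_distribution \<nu>" and f: "\<And>t. 0 < t \<Longrightarrow> is_LS_transform (f t)"
    and fm: "\<And>s. 0 \<le> s \<Longrightarrow> (\<lambda>t. f t s) \<in> borel_measurable borel"
    and fc: "\<And>s. 0 \<le> s \<Longrightarrow> continuous_on {0..} (\<lambda>t. f t s)"
    and fb: "\<And>s t. 0 \<le> s \<Longrightarrow> 0 \<le> t \<Longrightarrow> \<bar>f t s\<bar> \<le> 1"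
    and lim: "((\<lambda>s. LINT t|\<nu>. f t s) \<longlongrightarrow> 1) (at_right 0)"
  shows "is_LS_transform (\<lambda>s. LINT t|\<nu>. f t s)"
proof (rule is_LS_transform_limit[OF _ _ lim])
  note [measurable_cong] = nonneg_distribution_props(2)[OF \<nu>]
  show "is_LS_transform (\<lambda>s. LINT t|\<nu>. f (grid n (grid_index n t)) s)" for n
    by (rule is_LS_transform_discrete_mixture[OF nonneg_distribution_props(1)[OF \<nu>]])
      (use f grid_pos in \<open>auto intro!: measurable_cong_sets\<close>)
  show "(\<lambda>n. LINT t|\<nu>. f (grid n (grid_index n t)) s) \<longlonglongrightarrow> (LINT t|\<nu>. f t s)" if "0 \<le> s" for s
    by (rule grid_integral_tendsto[OF \<nu>]) (use fm fc fb that in auto)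
qed

section \<open>Exponents of infinitely divisible laws\<close>

lemma chord_continuous:
  assumes F: "nonneg_distribution F" and m: "emean F = ennreal m" "0 \<le> m"
    and q: "\<And>s. 0 \<le> s \<Longrightarrow> LS_transform F s \<le> 1 - m * s + M / 2 * s\<^sup>2" and s: "0 \<le> s"
  shows "continuous_on {0..} (chord m F s)"
  unfolding continuous_on_eq_continuous_within
proof
  fix t :: real assume t: "t \<in> {0..}"
  show "continuous (at t within {0..}) (chord m F s)"
  proof (cases "t = 0")
    case True
    have "((chord m F s) \<longlongrightarrow> m * s) (at 0 within {0..})"
    proof (rule tendsto_sandwich)
      show "\<forall>\<^sub>F t in at 0 within {0..}. m * s - M / 2 * s\<^sup>2 * t \<le> chord m F s t"
        "\<forall>\<^sub>F t in at 0 within {0..}. chord m F s t \<le> m * s"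
        using chord_ge[OF F m q s] chord_bounds[OF F m s] by (auto simp: eventually_at_filter)
      show "((\<lambda>t. m * s - M / 2 * s\<^sup>2 * t) \<longlongrightarrow> m * s) (at 0 within {0..})"
        by (auto intro!: tendsto_eq_intros)
    qed simp
    then show ?thesis using True by (simp add: continuous_within chord_def)
  next
    case False
    with t have t: "0 < t" by simp
    have "continuous_on {0..} (LS_transform F)"
    proof (rule lipschitz_on_continuous_on)
      show "m-lipschitz_on {0..} (LS_transform F)"
        using LS_transform_Lipschitz[OF F m] m(2) by (intro lipschitz_onI) (auto simp: dist_real_def)
    qed
    have "continuous_on {0<..} (\<lambda>t. (1 - LS_transform F (t * s)) / t)"
      by (intro continuous_intros continuous_on_compose2[OF \<open>continuous_on {0..} _\<close>]) (use s in auto)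
    then have "continuous_on {0<..} (chord m F s)"
      by (rule continuous_on_eq) (auto simp: chord_def)
    then have "isCont (chord m F s) t"
      using t by (simp add: continuous_on_eq_continuous_at)
    then show ?thesis by (rule continuous_at_imp_continuous_at_within)
  qed
qed

text \<open>
  With \<open>q = c / (1 + c)\<close>, the function equals \<open>((1 - q) / (1 - q * f s)) powr a\<close>. Its binomial series is the mixture of
  the powers of \<open>f\<close> with negative binomial weights.
\<close>

lemma is_LS_transform_neg_binomial:
  assumes f: "is_LS_transform f" and c: "0 \<le> c" and a: "0 < a"
  shows "is_LS_transform (\<lambda>s. (1 + c * (1 - f s)) powr (- a))"
proof -
  define q where "q = c / (1 + c)"
  have q: "0 \<le> q" "q < 1" "1 - q = 1 / (1 + c)"
    using c by (auto simp: q_def field_simps)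
  define w where "w k = (1 + c) powr (- a) * (pochhammer a k / fact k * q ^ k)" for k
  have coeff: "((- a) gchoose k) * (- x) ^ k = pochhammer a k / fact k * x ^ k" for k x
  proof -
    have "(- 1) ^ k * (- 1) ^ k = (1::real)" by (simp add: power_mult_distrib[symmetric])
    moreover have "((- a) gchoose k) * (- x) ^ k
        = ((- 1) ^ k * (- 1) ^ k) * (pochhammer a k / fact k * x ^ k)"
      unfolding gbinomial_pochhammer power_minus[of x] by simp
    ultimately show ?thesis by simp
  qed
  have series: "(\<lambda>k. w k * y ^ k) sums (1 + c * (1 - y)) powr (- a)" if y: "0 \<le> y" "y \<le> 1" for y
  proof -
    have qy: "0 \<le> q * y" "q * y < 1"
      using q y mult_left_le[of y q] by auto
    have "(\<lambda>k. pochhammer a k / fact k * (q * y) ^ k) sums (1 - q * y) powr (- a)"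
      using gen_binomial_real[of "- (q * y)" "- a"] qy unfolding coeff by simp
    then have "(\<lambda>k. (1 + c) powr (- a) * (pochhammer a k / fact k * (q * y) ^ k)) sums
        ((1 + c) powr (- a) * (1 - q * y) powr (- a))"
      by (rule sums_mult)
    moreover have "(1 + c) powr (- a) * (1 - q * y) powr (- a) = ((1 + c) * (1 - q * y)) powr (- a)"
      using c qy by (simp add: powr_mult)
    moreover have "(1 + c) * (1 - q * y) = 1 + c * (1 - y)"
      using c by (simp add: q_def field_simps)
    ultimately show ?thesis by (simp add: w_def power_mult_distrib mult_ac)
  qed
  have "0 \<le> pochhammer a k" for k by (rule pochhammer_nonneg[OF a])
  then have w: "0 \<le> w k" for k using q by (simp add: w_def)
  have "w sums 1" using series[of 1] by simp
  from is_LS_transform_series[OF w this is_LS_transform_power[OF f]] show ?thesis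
  proof (rule is_LS_transform_cong)
    show "(1 + c * (1 - f s)) powr (- a) = (\<Sum>k. w k * f s ^ k)" if "0 \<le> s" for s
      by (rule sums_unique[OF series]) (use is_LS_transform_bounds[OF f that] in auto)
  qed
qed

text \<open>
  Those of these functions that tend to \<open>0\<close> at the origin are the Laplace exponents of infinitely divisible laws, described as limits of exponents
  \<open>c * (1 - f s)\<close> of compound Poisson laws.
\<close>

definition Bernstein_limit :: "(real \<Rightarrow> real) \<Rightarrow> bool" where
  "Bernstein_limit \<psi> \<longleftrightarrow> (\<exists>c f. (\<forall>n. 0 \<le> c n \<and> is_LS_transform (f n)) \<and>
     (\<forall>s\<ge>0. (\<lambda>n::nat. c n * (1 - f n s)) \<longlonglongrightarrow> \<psi> s))"

lemma Bernstein_limit_nonneg: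
  assumes "Bernstein_limit \<psi>" "0 \<le> s"
  shows "0 \<le> \<psi> s"
proof -
  from assms obtain c f where "\<And>n::nat. 0 \<le> c n \<and> is_LS_transform (f n)"
    and "(\<lambda>n. c n * (1 - f n s)) \<longlonglongrightarrow> \<psi> s" unfolding Bernstein_limit_def by blast
  then show ?thesis
    using is_LS_transform_bounds(2)[OF _ assms(2)] by (intro LIMSEQ_le_const[of _ "\<psi> s"]) auto
qed

lemma is_LS_transform_powr_Bernstein:
  assumes \<psi>: "Bernstein_limit \<psi>" and z: "(\<psi> \<longlongrightarrow> 0) (at_right 0)" and l: "0 \<le> l" and a: "0 < a"
  shows "is_LS_transform (\<lambda>s. (1 + l * \<psi> s) powr (- a))"
proof -
  from \<psi> obtain c f where c: "\<And>n::nat. 0 \<le> c n" and f: "\<And>n. is_LS_transform (f n)"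
    and lim: "\<And>s. 0 \<le> s \<Longrightarrow> (\<lambda>n. c n * (1 - f n s)) \<longlonglongrightarrow> \<psi> s" unfolding Bernstein_limit_def by blast
  show ?thesis
  proof (rule is_LS_transform_limit)
    show "is_LS_transform (\<lambda>s. (1 + (l * c n) * (1 - f n s)) powr (- a))" for n
      by (rule is_LS_transform_neg_binomial[OF f _ a]) (use c l in simp)
    fix s :: real assume s: "0 \<le> s"
    have "1 + l * \<psi> s \<noteq> 0"
      using mult_nonneg_nonneg[OF l Bernstein_limit_nonneg[OF \<psi> s]] by linarith
    then have "(\<lambda>n. (1 + l * (c n * (1 - f n s))) powr (- a)) \<longlonglongrightarrow> (1 + l * \<psi> s) powr (- a)"
      by (intro tendsto_intros lim[OF s]) auto
    then show "(\<lambda>n. (1 + (l * c n) * (1 - f n s)) powr (- a)) \<longlonglongrightarrow> (1 + l * \<psi> s) powr (- a)"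
      by (simp add: mult.assoc)
  next
    have "((\<lambda>s. (1 + l * \<psi> s) powr (- a)) \<longlongrightarrow> (1 + l * 0) powr (- a)) (at_right 0)"
      by (intro tendsto_intros z) auto
    then show "((\<lambda>s. (1 + l * \<psi> s) powr (- a)) \<longlongrightarrow> 1) (at_right 0)" by simp
  qed
qed

text \<open>
  The exponential is the limit of \<open>(1 + b / n * \<psi>) powr (- n)\<close>.
\<close>

lemma is_LS_transform_exp_Bernstein:
  assumes \<psi>: "Bernstein_limit \<psi>" and z: "(\<psi> \<longlongrightarrow> 0) (at_right 0)" and b: "0 \<le> b"
  shows "is_LS_transform (\<lambda>s. exp (- (b * \<psi> s)))"
proof (rule is_LS_transform_limit)
  show "is_LS_transform (\<lambda>s. (1 + b / real (Suc n) * \<psi> s) powr (- real (Suc n)))" for n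
    by (rule is_LS_transform_powr_Bernstein[OF \<psi> z]) (use b in auto)
  fix s :: real assume s: "0 \<le> s"
  define x where "x = b * \<psi> s"
  have x: "0 \<le> x" using b Bernstein_limit_nonneg[OF \<psi> s] by (simp add: x_def)
  have "(\<lambda>n. inverse ((1 + x / real n) ^ n)) \<longlonglongrightarrow> inverse (exp x)"
    by (intro tendsto_inverse tendsto_exp_limit_sequentially) simp
  then have "(\<lambda>n. inverse ((1 + x / real (Suc n)) ^ Suc n)) \<longlonglongrightarrow> inverse (exp x)"
    by (rule LIMSEQ_Suc)
  moreover have "inverse ((1 + x / real (Suc n)) ^ Suc n)
      = (1 + b / real (Suc n) * \<psi> s) powr (- real (Suc n))" for n
  proof -
    have p: "0 < 1 + x / real (Suc n)" using x by (simp add: add_pos_nonneg)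
    have "inverse ((1 + x / real (Suc n)) ^ Suc n) = (1 + x / real (Suc n)) powr (- real (Suc n))"
      by (simp only: powr_minus powr_realpow[OF p])
    then show ?thesis by (simp add: x_def)
  qed
  ultimately show "(\<lambda>n. (1 + b / real (Suc n) * \<psi> s) powr (- real (Suc n))) \<longlonglongrightarrow> exp (- (b * \<psi> s))"
    by (simp add: exp_minus x_def)
next
  have "((\<lambda>s. exp (- (b * \<psi> s))) \<longlongrightarrow> exp (- (b * 0))) (at_right 0)"
    by (intro tendsto_intros z)
  then show "((\<lambda>s. exp (- (b * \<psi> s))) \<longlongrightarrow> 1) (at_right 0)" by simp
qed

text \<open>
  After discretisation, the integral of chords is an integral of multiples of \<open>1 - LS_transform F (t * u s)\<close>,
  with factors up to \<open>Suc n\<close>. Diluting each transform with the constant \<open>1\<close> absorbs these factors into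
  a single constant, leaving one mixture of transforms. The map \<open>u\<close> allows the lemma to be applied
  first to \<open>sigma\<close> itself and then to \<open>sigma_B\<close> composed with it.
\<close>

lemma Bernstein_limit_sigma:
  assumes F: "nonneg_distribution F" and m: "emean F = ennreal m" "0 \<le> m"
    and q: "\<And>s. 0 \<le> s \<Longrightarrow> LS_transform F s \<le> 1 - m * s + M / 2 * s\<^sup>2"
    and \<nu>: "nonneg_distribution \<nu>" and u: "\<And>s. 0 \<le> s \<Longrightarrow> 0 \<le> u s"
    and LS: "\<And>t. 0 < t \<Longrightarrow> is_LS_transform (\<lambda>s. LS_transform F (t * u s))"
  shows "Bernstein_limit (\<lambda>s. sigma m \<nu> F (u s))"
proof -
  note [measurable_cong] = nonneg_distribution_props(2)[OF \<nu>]
  \<comment> \<open>The weight is chosen so that \<open>real (Suc n) * w k\<close> is the reciprocal of \<open>grid n k\<close>.\<close>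
  define w where "w k = 1 / real (Suc k)" for k
  have w: "0 \<le> w k" "w k \<le> 1" for k by (auto simp: w_def)
  define f where "f n k s = w k * LS_transform F (grid n k * u s) + (1 - w k) * 1" for n k s
  have f: "is_LS_transform (f n k)" for n k
    unfolding f_def
    by (rule is_LS_transform_convex[OF LS[OF grid_pos] _ w]) (use is_LS_transform_exp[of 0] in simp)
  define g where "g n s = (LINT t|\<nu>. f n (grid_index n t) s)" for n s
  have g: "is_LS_transform (g n)" for n
    unfolding g_def
    by (rule is_LS_transform_discrete_mixture[OF nonneg_distribution_props(1)[OF \<nu>]]) (use f in auto)
  have "(\<lambda>n. real (Suc n) * (1 - g n s)) \<longlonglongrightarrow> sigma m \<nu> F (u s)" if s: "0 \<le> s" for s
  proof -
    have c: "real (Suc n) * (1 - f n k s) = chord m F (u s) (grid n k)" for n k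
    proof -
      have "real (Suc n) * (1 - f n k s)
          = (real (Suc n) * w k) * (1 - LS_transform F (grid n k * u s))"
        unfolding f_def by algebra
      also have "real (Suc n) * w k = 1 / grid n k" by (simp add: w_def grid_def)
      finally show ?thesis using grid_pos[of n k] by (simp add: chord_def)
    qed
    have "real (Suc n) * (1 - g n s) = (LINT t|\<nu>. chord m F (u s) (grid n (grid_index n t)))" for n
    proof -
      have "integrable \<nu> (\<lambda>t. f n (grid_index n t) s)"
        by (rule nonneg_distribution_integrable[OF \<nu>, where B = 1])
          (use is_LS_transform_bounds[OF f s] in auto)
      moreover have "integrable \<nu> (\<lambda>t. 1::real)"
        by (rule nonneg_distribution_integrable[OF \<nu>, where B = 1]) auto
      ultimately have "1 - g n s = (LINT t|\<nu>. 1 - f n (grid_index n t) s)"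
        using nonneg_distribution_integral_const[OF \<nu>, of 1] by (simp add: g_def)
      then show ?thesis by (simp only: c[symmetric] integral_mult_right_zero)
    qed
    moreover have "(\<lambda>n. LINT t|\<nu>. chord m F (u s) (grid n (grid_index n t))) \<longlonglongrightarrow> sigma m \<nu> F (u s)"
      unfolding sigma_eq_integral_chord
      by (rule grid_integral_tendsto[OF \<nu> chord_measurable[OF F] chord_continuous[OF F m q u[OF s]],
            where B = "m * u s"])
        (use chord_bounds[OF F m u[OF s]] in auto)
    ultimately show ?thesis by simp
  qed
  then show ?thesis
    unfolding Bernstein_limit_def
    by (intro exI[of _ "\<lambda>n. real (Suc n)"] exI[of _ g]) (use g in auto)
qed

lemma tendsto_0_of_linear_bound:
  fixes \<psi> :: "real \<Rightarrow> real"
  assumes "\<And>s. 0 \<le> s \<Longrightarrow> 0 \<le> \<psi> s" "\<And>s. 0 \<le> s \<Longrightarrow> \<psi> s \<le> C * s"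
  shows "(\<psi> \<longlongrightarrow> 0) (at_right 0)"
proof (rule tendsto_sandwich[of "\<lambda>_. 0" _ _ "\<lambda>s. C * s"])
  show "\<forall>\<^sub>F s in at_right 0. 0 \<le> \<psi> s" "\<forall>\<^sub>F s in at_right 0. \<psi> s \<le> C * s"
    using assms by (auto simp: eventually_at_filter)
  show "((\<lambda>s. C * s) \<longlongrightarrow> 0) (at_right 0)" by (auto intro!: tendsto_eq_intros)
qed simp

lemma unit_mass:
  "nonneg_distribution (return borel (1::real))" "emean (return borel (1::real)) = ennreal 1"
  "emoment 2 (return borel (1::real)) = ennreal 1"
  "0 \<le> s \<Longrightarrow> LS_transform (return borel 1) s \<le> 1 - 1 * s + 1 / 2 * s\<^sup>2"
  using point_mass[of 1] exp_neg_le_quadratic[of s] by auto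

section \<open>The right-hand side of the equation\<close>

definition equation_rhs :: "real \<Rightarrow> real \<Rightarrow> real measure \<Rightarrow> real measure \<Rightarrow> real measure \<Rightarrow> real measure \<Rightarrow> real \<Rightarrow> real" where
  "equation_rhs \<mu> a F\<^sub>T F\<^sub>B F\<^sub>\<Lambda> F s = (LINT l|F\<^sub>\<Lambda>. (1 + l * sigma_B F\<^sub>B (sigma \<mu> F\<^sub>T F s)) powr (- a))"

lemma sigma_B_bounds:
  assumes "nonneg_distribution B" "0 \<le> y"
  shows "0 \<le> sigma_B B y" "sigma_B B y \<le> y"
  using sigma_bounds[OF unit_mass(1,2) _ assms] by (auto simp: sigma_B_eq_sigma[OF assms])

lemma sigma_B_Lipschitz:
  assumes "nonneg_distribution B" "0 \<le> x" "0 \<le> y"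
  shows "\<bar>sigma_B B x - sigma_B B y\<bar> \<le> \<bar>x - y\<bar>"
  using sigma_Lipschitz[OF unit_mass(1,2) _ assms(1,2,3)] assms by (simp add: sigma_B_eq_sigma)

lemma sigma_B_ge:
  assumes "nonneg_distribution B" "emean B = ennreal b" "0 \<le> b" "0 \<le> y"
  shows "y - b / 2 * y\<^sup>2 \<le> sigma_B B y"
  using sigma_ge[OF unit_mass(1,2) _ unit_mass(4) assms] assms by (simp add: sigma_B_eq_sigma mult.commute)

lemma powr_mixture_integrable:
  assumes L: "nonneg_distribution L" and "0 \<le> y" "0 < a"
  shows "integrable L (\<lambda>l. (1 + l * y) powr (- a))"
  by (rule nonneg_distribution_integrable[OF L, where B = 1])
    (use assms powr_neg_le_one in auto)

lemma powr_mixture_remainder: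
  assumes L: "nonneg_distribution L" and l: "emean L = ennreal e" "0 \<le> e" and y: "0 \<le> y" and a: "0 < a"
  shows "1 - a * e * y \<le> (LINT l|L. (1 + l * y) powr (- a))"
proof -
  note mean = emean_eq_ennreal[OF L l]
  have one: "integrable L (\<lambda>l. 1::real)"
    by (rule nonneg_distribution_integrable[OF L, where B = 1]) auto
  have "1 - a * e * y = (LINT l|L. 1 - a * y * l)"
    using mean one nonneg_distribution_integral_const[OF L, of 1] by simp
  also have "\<dots> \<le> (LINT l|L. (1 + l * y) powr (- a))"
  proof (rule nonneg_distribution_integral_mono[OF L _ powr_mixture_integrable[OF L y a]])
    show "1 - a * y * l \<le> (1 + l * y) powr (- a)" if "0 \<le> l" for l
      using powr_neg_ge_linear[of "l * y" a] that y a by (simp add: mult_ac)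
  qed (use one mean in auto)
  finally show ?thesis .
qed

lemma powr_mixture_le_quadratic:
  assumes L: "nonneg_distribution L" and l: "emean L = ennreal e" "0 \<le> e"
    and l2: "emoment 2 L = ennreal e2" "0 \<le> e2" and y: "0 \<le> y" and a: "0 < a"
  shows "(LINT l|L. (1 + l * y) powr (- a)) \<le> 1 - a * e * y + a * (a + 1) / 2 * e2 * y\<^sup>2"
proof -
  note mean = emean_eq_ennreal[OF L l]
  have sq: "integrable L (\<lambda>x. x\<^sup>2)" "(LINT x|L. x\<^sup>2) = e2"
    using emoment_eq_integral[OF L, of 2] l2 nonneg_distribution_integral_nonneg[OF L, of "\<lambda>x. x\<^sup>2"]
    by auto
  have one: "integrable L (\<lambda>l. 1::real)"
    by (rule nonneg_distribution_integrable[OF L, where B = 1]) auto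
  have "(LINT l|L. (1 + l * y) powr (- a)) \<le> (LINT l|L. 1 - a * y * l + a * (a + 1) / 2 * y\<^sup>2 * l\<^sup>2)"
  proof (rule nonneg_distribution_integral_mono[OF L powr_mixture_integrable[OF L y a]])
    show "(1 + l * y) powr (- a) \<le> 1 - a * y * l + a * (a + 1) / 2 * y\<^sup>2 * l\<^sup>2" if "0 \<le> l" for l
      using powr_neg_le_quadratic[of "l * y" a] that y a by (simp add: mult_ac power_mult_distrib)
  qed (use one mean sq in auto)
  also have "\<dots> = 1 - a * e * y + a * (a + 1) / 2 * e2 * y\<^sup>2"
    using mean one sq nonneg_distribution_integral_const[OF L, of 1] by (simp add: algebra_simps)
  finally show ?thesis .
qed

lemma powr_mixture_Lipschitz:
  assumes L: "nonneg_distribution L" and l: "emean L = ennreal e" "0 \<le> e"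
    and x: "0 \<le> x" and y: "0 \<le> y" and a: "0 < a"
  shows "\<bar>(LINT l|L. (1 + l * x) powr (- a)) - (LINT l|L. (1 + l * y) powr (- a))\<bar> \<le> a * e * \<bar>x - y\<bar>"
proof -
  note mean = emean_eq_ennreal[OF L l]
  have "\<bar>(LINT l|L. (1 + l * x) powr (- a)) - (LINT l|L. (1 + l * y) powr (- a))\<bar>
      \<le> (LINT l|L. a * \<bar>x - y\<bar> * l)"
  proof (rule nonneg_distribution_integral_diff_le[OF L powr_mixture_integrable[OF L x a]
        powr_mixture_integrable[OF L y a]])
    fix l :: real assume l: "0 \<le> l"
    have "\<bar>l * x - l * y\<bar> = \<bar>x - y\<bar> * l"
      using l by (simp add: right_diff_distrib[symmetric] abs_mult)
    then show "\<bar>(1 + l * x) powr (- a) - (1 + l * y) powr (- a)\<bar> \<le> a * \<bar>x - y\<bar> * l"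
      using powr_neg_Lipschitz[of "l * x" "l * y" a] l x y a by simp
  qed (use mean in auto)
  then show ?thesis using mean by (simp add: mult_ac)
qed

text \<open>
  The construction climbs through the equation: \<open>sigma\<close> is an exponent, hence so is \<open>sigma_B\<close> of it, hence the
  negative powers are transforms, and the integral over \<open>F\<^sub>\<Lambda>\<close> is a mixture of them.
\<close>

lemma equation_rhs_is_LS_transform:
  assumes T: "nonneg_distribution F\<^sub>T" and B: "nonneg_distribution F\<^sub>B" and L: "nonneg_distribution F\<^sub>\<Lambda>"
    and l: "emean F\<^sub>\<Lambda> = ennreal e" "0 \<le> e" and a: "0 < a"
    and F: "nonneg_distribution F" and m: "emean F = ennreal \<mu>" "0 \<le> \<mu>"
    and q: "\<And>s. 0 \<le> s \<Longrightarrow> LS_transform F s \<le> 1 - \<mu> * s + M / 2 * s\<^sup>2"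
  shows "is_LS_transform (equation_rhs \<mu> a F\<^sub>T F\<^sub>B F\<^sub>\<Lambda> F)"
proof -
  define \<sigma> where "\<sigma> = sigma \<mu> F\<^sub>T F"
  have \<sigma>_bounds: "0 \<le> \<sigma> s" "\<sigma> s \<le> \<mu> * s" if "0 \<le> s" for s
    using sigma_bounds[OF F m T that] by (auto simp: \<sigma>_def)
  have "Bernstein_limit (\<lambda>s. sigma \<mu> F\<^sub>T F s)"
  proof (rule Bernstein_limit_sigma[OF F m q T])
    show "is_LS_transform (\<lambda>s. LS_transform F (t * s))" if "0 < t" for t
      by (rule is_LS_transform_scale[OF is_LS_transformI[OF F]]) (use that in auto)
  qed
  then have \<sigma>: "Bernstein_limit \<sigma>" by (simp add: \<sigma>_def)
  have \<sigma>0: "(\<sigma> \<longlongrightarrow> 0) (at_right 0)"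
    by (rule tendsto_0_of_linear_bound[of _ \<mu>]) (use \<sigma>_bounds in auto)
  have "Bernstein_limit (\<lambda>s. sigma 1 F\<^sub>B (return borel 1) (\<sigma> s))"
  proof (rule Bernstein_limit_sigma[OF unit_mass(1,2) _ unit_mass(4) B])
    show "is_LS_transform (\<lambda>s. LS_transform (return borel 1) (t * \<sigma> s))" if "0 < t" for t
      using is_LS_transform_exp_Bernstein[OF \<sigma> \<sigma>0, of t] that by (simp add: point_mass(2))
  qed (use \<sigma>_bounds in auto)
  then have \<psi>: "Bernstein_limit (\<lambda>s. sigma_B F\<^sub>B (\<sigma> s))"
    unfolding Bernstein_limit_def using sigma_B_eq_sigma[OF B \<sigma>_bounds(1)] by simp
  have \<psi>_bounds: "0 \<le> sigma_B F\<^sub>B (\<sigma> s)" "sigma_B F\<^sub>B (\<sigma> s) \<le> \<mu> * s" if "0 \<le> s" for s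
    using sigma_B_bounds[OF B \<sigma>_bounds(1)[OF that]] \<sigma>_bounds(2)[OF that] by auto
  have \<psi>0: "((\<lambda>s. sigma_B F\<^sub>B (\<sigma> s)) \<longlongrightarrow> 0) (at_right 0)"
    by (rule tendsto_0_of_linear_bound[of _ \<mu>]) (use \<psi>_bounds in auto)
  have "is_LS_transform (\<lambda>s. LINT l|F\<^sub>\<Lambda>. (1 + l * sigma_B F\<^sub>B (\<sigma> s)) powr (- a))"
  proof (rule is_LS_transform_mixture[OF L])
    show "is_LS_transform (\<lambda>s. (1 + l * sigma_B F\<^sub>B (\<sigma> s)) powr (- a))" if "0 < l" for l
      by (rule is_LS_transform_powr_Bernstein[OF \<psi> \<psi>0]) (use that a in auto)
    fix s :: real assume s: "0 \<le> s"
    have p: "0 < 1 + l * sigma_B F\<^sub>B (\<sigma> s)" if "0 \<le> l" for l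
      using mult_nonneg_nonneg[OF that \<psi>_bounds(1)[OF s]] by simp
    show "continuous_on {0..} (\<lambda>l. (1 + l * sigma_B F\<^sub>B (\<sigma> s)) powr (- a))"
      using p by (intro continuous_intros) (auto simp: less_imp_neq[symmetric])
    show "\<bar>(1 + l * sigma_B F\<^sub>B (\<sigma> s)) powr (- a)\<bar> \<le> 1" if "0 \<le> l" for l
      using powr_neg_le_one[of "l * sigma_B F\<^sub>B (\<sigma> s)" a] \<psi>_bounds[OF s] that a by simp
  next
    let ?g = "\<lambda>s. LINT l|F\<^sub>\<Lambda>. (1 + l * sigma_B F\<^sub>B (\<sigma> s)) powr (- a)"
    have "((\<lambda>s. 1 - ?g s) \<longlongrightarrow> 0) (at_right 0)"
    proof (rule tendsto_0_of_linear_bound[of _ "a * e * \<mu>"])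
      fix s :: real assume s: "0 \<le> s"
      have "1 - ?g s \<le> a * e * sigma_B F\<^sub>B (\<sigma> s)"
        using powr_mixture_remainder[OF L l \<psi>_bounds(1)[OF s] a] by simp
      also have "\<dots> \<le> a * e * (\<mu> * s)" using \<psi>_bounds(2)[OF s] a l by (intro mult_left_mono) auto
      finally show "1 - ?g s \<le> a * e * \<mu> * s" by (simp add: mult_ac)
      have "?g s \<le> 1"
        by (rule nonneg_distribution_integral_le_const[OF L])
          (use powr_neg_le_one \<psi>_bounds[OF s] a in auto)
      then show "0 \<le> 1 - ?g s" by simp
    qed
    from tendsto_diff[OF tendsto_const[of 1] this] show "(?g \<longlongrightarrow> 1) (at_right 0)" by simp
  qed auto
  then show ?thesis by (simp add: equation_rhs_def[abs_def] \<sigma>_def)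
qed

section \<open>Necessity of the moment conditions and the variance\<close>

lemma evar_finite_iff:
  assumes F: "nonneg_distribution F" and m: "emean F = ennreal m" "0 \<le> m"
  shows "evar F < \<infinity> \<longleftrightarrow> emoment 2 F < \<infinity>"
proof -
  note mean = emean_eq_ennreal[OF F m]
  have c: "integrable F (\<lambda>x. c)" for c :: real
    by (rule nonneg_distribution_integrable[OF F, where B = "\<bar>c\<bar>"]) auto
  have iff: "(\<integral>\<^sup>+x. ennreal (f x) \<partial>F) < \<infinity> \<longleftrightarrow> integrable F f"
    if f: "f \<in> borel_measurable borel" and nn: "\<And>x. 0 \<le> f x" for f :: "real \<Rightarrow> real"
  proof
    assume "(\<integral>\<^sup>+x. ennreal (f x) \<partial>F) < \<infinity>"
    then show "integrable F f"
      by (intro integrableI_nonneg nonneg_distribution_measurable[OF F f]) (use nn in auto)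
  next
    assume "integrable F f"
    from nn_integral_eq_integral[OF this] nn show "(\<integral>\<^sup>+x. ennreal (f x) \<partial>F) < \<infinity>" by simp
  qed
  have "evar F < \<infinity> \<longleftrightarrow> integrable F (\<lambda>x. (x - mean F)\<^sup>2)"
    unfolding evar_def by (rule iff) auto
  also have "\<dots> \<longleftrightarrow> integrable F (\<lambda>x. x\<^sup>2)"
  proof
    assume "integrable F (\<lambda>x. (x - mean F)\<^sup>2)"
    then have "integrable F (\<lambda>x. (x - mean F)\<^sup>2 + 2 * x * mean F - (mean F)\<^sup>2)"
      using mean c by (intro Bochner_Integration.integrable_diff Bochner_Integration.integrable_add) auto
    then show "integrable F (\<lambda>x. x\<^sup>2)" by (simp add: power2_diff)
  next
    assume "integrable F (\<lambda>x. x\<^sup>2)"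
    then have "integrable F (\<lambda>x. x\<^sup>2 + (mean F)\<^sup>2 - 2 * x * mean F)"
      using mean c by (intro Bochner_Integration.integrable_diff Bochner_Integration.integrable_add) auto
    then show "integrable F (\<lambda>x. (x - mean F)\<^sup>2)" by (simp add: power2_diff)
  qed
  also have "\<dots> \<longleftrightarrow> emoment 2 F < \<infinity>"
    unfolding emoment_def by (rule iff[symmetric]) auto
  finally show ?thesis .
qed

lemma second_moment_eq:
  assumes F: "nonneg_distribution F" and "emoment 2 F = ennreal m2" "0 \<le> m2"
  shows "integrable F (\<lambda>x. x\<^sup>2)" "(LINT x|F. x\<^sup>2) = m2"
  using emoment_eq_integral[OF F, of 2] assms nonneg_distribution_integral_nonneg[OF F, of "\<lambda>x. x\<^sup>2"]
  by auto

lemma var_eq: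
  assumes F: "nonneg_distribution F" and m: "emean F = ennreal m" "0 \<le> m"
    and m2: "emoment 2 F = ennreal m2" "0 \<le> m2"
  shows "var F = m2 - m\<^sup>2" "m\<^sup>2 \<le> m2"
proof -
  note mean = emean_eq_ennreal[OF F m] and sq = second_moment_eq[OF F m2]
  have c: "integrable F (\<lambda>x. m\<^sup>2)"
    by (rule nonneg_distribution_integrable[OF F, where B = "\<bar>m\<^sup>2\<bar>"]) auto
  have "var F = (LINT x|F. x\<^sup>2 + m\<^sup>2 - 2 * x * m)"
    using mean by (simp add: var_def mean_def power2_diff)
  also have "\<dots> = m2 + m\<^sup>2 - 2 * m * m"
    using mean sq c nonneg_distribution_integral_const[OF F, of "m\<^sup>2"] by simp
  finally show "var F = m2 - m\<^sup>2" by (simp add: power2_eq_square)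
  moreover have "0 \<le> var F" unfolding var_def by simp
  ultimately show "m\<^sup>2 \<le> m2" by simp
qed

lemma powr_mixture_first_order:
  assumes L: "nonneg_distribution L" and a: "0 < a" and y: "y \<longlonglongrightarrow> 0" "\<And>n. 0 < y n"
  shows "(\<lambda>n. ennreal ((1 - (LINT l|L. (1 + l * y n) powr (- a))) / y n)) \<longlonglongrightarrow> ennreal a * emean L"
proof -
  let ?q = "\<lambda>x::real. (1 - (1 + x) powr (- a)) / x"
  have "(\<lambda>n. \<integral>\<^sup>+x. ennreal (x ^ 1 * ?q (y n * x)) \<partial>L) \<longlonglongrightarrow> ennreal a * emean L"
  proof (rule scaled_moment_limit[OF L _ _ _ _ _ y])
    show "0 \<le> ?q x \<and> ?q x \<le> a" if "0 < x" for x
      using powr_neg_ge_linear[of x a] powr_neg_le_one[of x a] that a by (simp add: field_simps)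
    show "(?q \<longlongrightarrow> a) (at_right 0)" using a by real_asymp
  qed (use a in auto)
  moreover have "(\<integral>\<^sup>+x. ennreal (x ^ 1 * ?q (y n * x)) \<partial>L)
      = ennreal ((1 - (LINT l|L. (1 + l * y n) powr (- a))) / y n)" for n
  proof -
    have i: "integrable L (\<lambda>l. (1 + l * y n) powr (- a))"
      by (rule powr_mixture_integrable[OF L _ a]) (simp add: less_imp_le y)
    have one: "integrable L (\<lambda>x. 1::real)"
      by (rule nonneg_distribution_integrable[OF L, of _ 1]) auto
    have i2: "integrable L (\<lambda>l. (1 - (1 + l * y n) powr (- a)) / y n)"
      using i one by (intro integrable_divide Bochner_Integration.integrable_diff)
    have "(\<integral>\<^sup>+x. ennreal (x ^ 1 * ?q (y n * x)) \<partial>L)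
        = (\<integral>\<^sup>+l. ennreal ((1 - (1 + l * y n) powr (- a)) / y n) \<partial>L)"
    proof (rule nonneg_distribution_nn_integral_cong[OF L])
      show "ennreal (x ^ 1 * ?q (y n * x)) = ennreal ((1 - (1 + x * y n) powr (- a)) / y n)" for x
        using y(2)[of n] by (cases "x = 0") (auto simp: mult.commute)
    qed
    also have "\<dots> = ennreal (LINT l|L. (1 - (1 + l * y n) powr (- a)) / y n)"
    proof (rule nonneg_distribution_nn_integral[OF L i2, symmetric])
      show "0 \<le> (1 - (1 + l * y n) powr (- a)) / y n" if "0 \<le> l" for l
        using powr_neg_le_one[of "l * y n" a] y(2)[of n] that a by simp
    qed
    also have "(LINT l|L. (1 - (1 + l * y n) powr (- a)) / y n)
        = (1 - (LINT l|L. (1 + l * y n) powr (- a))) / y n"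
      using i one nonneg_distribution_integral_const[OF L, of 1] by simp
    finally show ?thesis .
  qed
  ultimately show ?thesis by simp
qed

lemma powr_mixture_second_order:
  assumes L: "nonneg_distribution L" and l: "emean L = ennreal e" "0 \<le> e" and a: "0 < a"
    and y: "y \<longlonglongrightarrow> 0" "\<And>n. 0 < y n"
  shows "(\<lambda>n. ennreal (((LINT l|L. (1 + l * y n) powr (- a)) - 1 + a * e * y n) / (y n)\<^sup>2))
    \<longlonglongrightarrow> ennreal (a * (a + 1) / 2) * emoment 2 L"
proof -
  note mean = emean_eq_ennreal[OF L l]
  let ?q = "\<lambda>x::real. ((1 + x) powr (- a) - 1 + a * x) / x\<^sup>2"
  have "(\<lambda>n. \<integral>\<^sup>+x. ennreal (x ^ 2 * ?q (y n * x)) \<partial>L) \<longlonglongrightarrow> ennreal (a * (a + 1) / 2) * emoment 2 L"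
  proof (rule scaled_moment_limit[OF L _ _ _ _ _ y])
    show "0 \<le> ?q x \<and> ?q x \<le> a * (a + 1) / 2" if "0 < x" for x
    proof -
      have "(1 + x) powr (- a) - 1 + a * x \<le> a * (a + 1) / 2 * x\<^sup>2"
        "0 \<le> (1 + x) powr (- a) - 1 + a * x"
        using powr_neg_le_quadratic[of x a] powr_neg_ge_linear[of x a] that a by auto
      then show ?thesis using that by (simp add: pos_divide_le_eq)
    qed
    show "(?q \<longlongrightarrow> a * (a + 1) / 2) (at_right 0)"
    proof -
      \<comment> \<open>The limit in the form that the asymptotic expansion produces.\<close>
      have "- a - 1 = - (a + 1)" by simp
      then have c: "- ((- a - 1) * a / 2) = a * (a + 1) / 2"
        by (simp only: mult_minus_left minus_divide_left[symmetric] minus_minus mult.commute)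
      have "(?q \<longlongrightarrow> - ((- a - 1) * a / 2)) (at_right 0)" using a by real_asymp
      then show ?thesis unfolding c .
    qed
  qed (use a in auto)
  moreover have "(\<integral>\<^sup>+x. ennreal (x ^ 2 * ?q (y n * x)) \<partial>L)
      = ennreal (((LINT l|L. (1 + l * y n) powr (- a)) - 1 + a * e * y n) / (y n)\<^sup>2)" for n
  proof -
    let ?r = "\<lambda>l. ((1 + l * y n) powr (- a) - 1 + a * y n * l) / (y n)\<^sup>2"
    have i: "integrable L (\<lambda>l. (1 + l * y n) powr (- a))"
      by (rule powr_mixture_integrable[OF L _ a]) (simp add: less_imp_le y)
    have one: "integrable L (\<lambda>x. 1::real)"
      by (rule nonneg_distribution_integrable[OF L, of _ 1]) auto
    have lin: "integrable L (\<lambda>l. a * y n * l)" using mean by simp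
    have i2: "integrable L ?r"
      using i one lin by (intro integrable_divide Bochner_Integration.integrable_diff Bochner_Integration.integrable_add)
    have "(\<integral>\<^sup>+x. ennreal (x ^ 2 * ?q (y n * x)) \<partial>L) = (\<integral>\<^sup>+l. ennreal (?r l) \<partial>L)"
    proof (rule nonneg_distribution_nn_integral_cong[OF L])
      show "ennreal (x ^ 2 * ?q (y n * x)) = ennreal (?r x)" for x
        using y(2)[of n] by (cases "x = 0") (auto simp: mult_ac power_mult_distrib)
    qed
    also have "\<dots> = ennreal (LINT l|L. ?r l)"
    proof (rule nonneg_distribution_nn_integral[OF L i2, symmetric])
      show "0 \<le> ?r l" if "0 \<le> l" for l
        using powr_neg_ge_linear[of "l * y n" a] y(2)[of n] that a
        by (intro divide_nonneg_nonneg) (auto simp: mult_ac)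
    qed
    also have "(LINT l|L. ?r l) = ((LINT l|L. (1 + l * y n) powr (- a)) - 1 + a * e * y n) / (y n)\<^sup>2"
      using i one lin mean nonneg_distribution_integral_const[OF L, of 1] by (simp add: mult_ac)
    finally show ?thesis .
  qed
  ultimately show ?thesis by simp
qed

lemma chord_mono:
  assumes F: "nonneg_distribution F" and m: "0 \<le> m" and "0 \<le> s" "s \<le> s'" "0 \<le> t"
  shows "chord m F s t \<le> chord m F s' t"
  using assms LS_transform_antimono[OF F, of "t * s" "t * s'"]
  by (auto simp: chord_def mult_left_mono divide_right_mono)

text \<open>
  By its first order expansion \<open>sigma\<close> is positive at small arguments, and it is nondecreasing.
\<close>

lemma sigma_pos:
  assumes F: "nonneg_distribution F" and m: "emean F = ennreal m" "0 < m"
    and \<nu>: "nonneg_distribution \<nu>" and s: "0 < s"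
  shows "0 < sigma m \<nu> F s"
proof -
  have m': "0 \<le> m" using m by simp
  let ?S = "\<lambda>n. s / real (Suc n)"
  have "(\<lambda>n. sigma m \<nu> F (?S n) / ?S n) \<longlonglongrightarrow> m"
    by (rule sigma_first_order[OF F m(1) m' \<nu>]) (use s in \<open>real_asymp | simp\<close>)+
  then have "\<forall>\<^sub>F n in sequentially. 0 < sigma m \<nu> F (?S n) / ?S n"
    using m(2) by (rule order_tendstoD)
  then obtain n where n: "0 < sigma m \<nu> F (?S n) / ?S n"
    using eventually_happens'[OF sequentially_bot] by blast
  have S: "0 < ?S n" "?S n \<le> s" using s by (auto simp: divide_le_eq mult_le_cancel_left1)
  have "sigma m \<nu> F (?S n) \<le> sigma m \<nu> F s"
    unfolding sigma_eq_integral_chord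
    by (rule nonneg_distribution_integral_mono[OF \<nu>])
      (use S s chord_integrable[OF F m(1) m' \<nu>] chord_mono[OF F m'] in auto)
  moreover have "0 < x" if "0 < x / y" "0 < y" for x y :: real
    using that by (simp add: zero_less_divide_iff)
  note this[OF n S(1)]
  ultimately show ?thesis by simp
qed

text \<open>
  A pointwise limit of transforms may lose part of the mean. Bounds on the limit itself recover the moments from the
  expansion at the origin.
\<close>

lemma moments_of_quadratic_bounds:
  assumes F: "nonneg_distribution F" and m: "0 \<le> m"
    and low: "\<And>s. 0 \<le> s \<Longrightarrow> 1 - m * s \<le> LS_transform F s"
    and up: "\<And>s. 0 \<le> s \<Longrightarrow> LS_transform F s \<le> 1 - m * s + M / 2 * s\<^sup>2"
  shows "emean F = ennreal m" "emoment 2 F < \<infinity>"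
proof -
  define s where "s n = 1 / real (Suc n)" for n
  have s: "s \<longlonglongrightarrow> 0" "0 < s n" for n unfolding s_def by real_asymp simp
  have "(\<lambda>n. (1 - LS_transform F (s n)) / s n) \<longlonglongrightarrow> m"
  proof (rule tendsto_sandwich[OF always_eventually always_eventually], rule_tac[1-2] allI)
    show "m - M / 2 * s n \<le> (1 - LS_transform F (s n)) / s n" for n
    proof -
      have "(m - M / 2 * s n) * s n \<le> 1 - LS_transform F (s n)"
        using up[of "s n"] s(2)[of n] by (simp add: algebra_simps power2_eq_square)
      then show ?thesis by (simp only: pos_le_divide_eq[OF s(2)])
    qed
    show "(1 - LS_transform F (s n)) / s n \<le> m" for n
      using low[of "s n"] s(2)[of n] by (simp add: pos_divide_le_eq)
    show "(\<lambda>n. m - M / 2 * s n) \<longlonglongrightarrow> m" by (auto intro!: tendsto_eq_intros s(1))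
  qed simp
  then have "(\<lambda>n. ennreal ((1 - LS_transform F (s n)) / s n)) \<longlonglongrightarrow> ennreal m"
    by (rule tendsto_ennrealI)
  from LIMSEQ_unique[OF LS_transform_first_order[OF F s] this] show mean: "emean F = ennreal m" .
  have "ennreal (1 / 2) * emoment 2 F \<le> ennreal (M / 2)"
  proof (rule LIMSEQ_le_const2[OF LS_transform_second_order[OF F mean m s]], intro exI allI impI)
    show "ennreal ((LS_transform F (s n) - 1 + m * s n) / (s n)\<^sup>2) \<le> ennreal (M / 2)" for n
      using up[of "s n"] s(2)[of n] by (intro ennreal_leI) (simp add: pos_divide_le_eq)
  qed
  then have "ennreal (1 / 2) * emoment 2 F < \<infinity>"
    by (rule le_less_trans) simp
  then show "emoment 2 F < \<infinity>" by (auto simp: ennreal_mult_less_top)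
qed

context
  fixes \<mu> a :: real and F\<^sub>T F\<^sub>B F\<^sub>\<Lambda> :: "real measure"
  assumes \<mu>: "0 < \<mu>" and a: "0 < a"
    and T: "nonneg_distribution F\<^sub>T" and B: "nonneg_distribution F\<^sub>B" and L: "nonneg_distribution F\<^sub>\<Lambda>"
begin

text \<open>
  Comparing the two sides of the equation at orders \<open>s\<close> and \<open>s\<^sup>2\<close>. At second order, the remainder of the transform is the sum of
  the nonnegative remainders of \<open>sigma\<close>, \<open>sigma_B\<close> and the mixed power, so there is no cancellation and the identity
  holds in the extended nonnegative reals.
\<close>

lemma solution_moment_identities:
  assumes F: "nonneg_distribution F" and m: "emean F = ennreal \<mu>"
    and m2: "emoment 2 F = ennreal m2" "0 \<le> m2"
    and sol: "\<And>s. 0 \<le> s \<Longrightarrow> LS_transform F s = equation_rhs \<mu> a F\<^sub>T F\<^sub>B F\<^sub>\<Lambda> F s"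
  shows "emean F\<^sub>\<Lambda> = ennreal (1 / a)"
    "ennreal (m2 / 2) = ennreal (m2 / 2) * emean F\<^sub>T
      + (ennreal (1 / 2) * emean F\<^sub>B * ennreal (\<mu>\<^sup>2)
      + ennreal (a * (a + 1) / 2) * emoment 2 F\<^sub>\<Lambda> * ennreal (\<mu>\<^sup>2))"
proof -
  have \<mu>': "0 \<le> \<mu>" using \<mu> by simp
  define s where "s n = 1 / real (Suc n)" for n
  define u where "u n = sigma \<mu> F\<^sub>T F (s n)" for n
  define v where "v n = sigma_B F\<^sub>B (u n)" for n
  define G where "G y = (LINT l|F\<^sub>\<Lambda>. (1 + l * y) powr (- a))" for y
  have s: "s \<longlonglongrightarrow> 0" "0 < s n" for n unfolding s_def by real_asymp simp
  have LSG: "LS_transform F (s n) = G (v n)" for n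
    using sol[of "s n"] s(2)[of n] by (simp add: equation_rhs_def G_def u_def v_def)
  have u_pos: "0 < u n" for n unfolding u_def by (rule sigma_pos[OF F m \<mu> T s(2)])
  have us: "(\<lambda>n. u n / s n) \<longlonglongrightarrow> \<mu>"
    unfolding u_def by (rule sigma_first_order[OF F m \<mu>' T s])
  have u_le: "u n \<le> \<mu> * s n" for n
    unfolding u_def using sigma_bounds[OF F m \<mu>' T, of "s n"] s(2)[of n] by simp
  have u0: "u \<longlonglongrightarrow> 0"
    using tendsto_mult[OF us s(1)] s(2)[THEN less_imp_neq] by simp
  have v_sigma: "v n = sigma 1 F\<^sub>B (return borel 1) (u n)" for n
    unfolding v_def using u_pos[of n] by (simp add: sigma_B_eq_sigma[OF B])
  have v_pos: "0 < v n" for n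
    unfolding v_sigma by (rule sigma_pos[OF unit_mass(1,2) _ B u_pos]) simp
  have vu: "(\<lambda>n. v n / u n) \<longlonglongrightarrow> 1"
    unfolding v_sigma by (rule sigma_first_order[OF unit_mass(1,2) _ B u0 u_pos]) simp
  have v_le: "v n \<le> u n" for n
    unfolding v_def using sigma_B_bounds[OF B] u_pos[of n] by simp
  have v0: "v \<longlonglongrightarrow> 0"
    using tendsto_mult[OF vu u0] u_pos[THEN less_imp_neq] by simp
  have vs: "(\<lambda>n. v n / s n) \<longlonglongrightarrow> \<mu>"
    using tendsto_mult[OF vu us] u_pos[THEN less_imp_neq] by simp

  have "(\<lambda>n. ennreal ((1 - G (v n)) / v n) * ennreal (v n / s n))
      \<longlonglongrightarrow> (ennreal a * emean F\<^sub>\<Lambda>) * ennreal \<mu>"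
    by (rule tendsto_mult_ennreal)
      (use powr_mixture_first_order[OF L a v0 v_pos] vs \<mu> in \<open>auto simp: G_def\<close>)
  moreover have "ennreal ((1 - G (v n)) / v n) * ennreal (v n / s n)
      = ennreal ((1 - LS_transform F (s n)) / s n)" for n
    using v_pos[of n] s(2)[of n] LS_transform_bounds(2)[OF F, of "s n"]
    by (subst ennreal_mult[symmetric]) (auto simp: LSG)
  ultimately have "(ennreal a * emean F\<^sub>\<Lambda>) * ennreal \<mu> = ennreal \<mu>"
    using LIMSEQ_unique[OF _ LS_transform_first_order[OF F s]] m by simp
  then show L1: "emean F\<^sub>\<Lambda> = ennreal (1 / a)"
  proof (cases "emean F\<^sub>\<Lambda>" rule: ennreal_cases)
    case (real e)
    then have "a * e * \<mu> = \<mu>"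
      using \<open>(ennreal a * emean F\<^sub>\<Lambda>) * ennreal \<mu> = ennreal \<mu>\<close> a \<mu>
      by (simp add: ennreal_mult[symmetric])
    then show ?thesis using real a \<mu> by (simp add: field_simps)
  next
    case top
    then show ?thesis
      using \<open>(ennreal a * emean F\<^sub>\<Lambda>) * ennreal \<mu> = ennreal \<mu>\<close> a \<mu>
      by (simp add: ennreal_mult_top ennreal_top_mult)
  qed

  \<comment> \<open>The normalised remainders of \<open>sigma\<close>, \<open>sigma_B\<close> and the mixed power.\<close>
  define R1 where "R1 n = (\<mu> * s n - u n) / (s n)\<^sup>2" for n
  define R2 where "R2 n = (u n - v n) / (u n)\<^sup>2" for n
  define R3 where "R3 n = (G (v n) - 1 + v n) / (v n)\<^sup>2" for n
  have R: "0 \<le> R1 n" "0 \<le> R2 n" "0 \<le> R3 n" for n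
    using u_le[of n] v_le[of n] powr_mixture_remainder[OF L L1 _ less_imp_le[OF v_pos[of n]] a] a
    by (auto simp: R1_def R2_def R3_def G_def)
  have l1: "(\<lambda>n. ennreal (R1 n)) \<longlonglongrightarrow> ennreal (m2 / 2) * emean F\<^sub>T"
    unfolding R1_def u_def by (rule sigma_second_order[OF F m \<mu>' m2 T s])
  have "(\<lambda>n. ennreal (R2 n)) \<longlonglongrightarrow> ennreal (1 / 2) * emean F\<^sub>B"
    using sigma_second_order[OF unit_mass(1,2) _ unit_mass(3) _ B u0 u_pos]
    unfolding R2_def v_sigma by simp
  then have l2: "(\<lambda>n. ennreal (R2 n) * ennreal ((u n / s n)\<^sup>2)) \<longlonglongrightarrow> ennreal (1 / 2) * emean F\<^sub>B * ennreal (\<mu>\<^sup>2)"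
    by (rule tendsto_mult_ennreal) (use \<mu> tendsto_power[OF us, of 2] in auto)
  have "(\<lambda>n. ennreal (R3 n)) \<longlonglongrightarrow> ennreal (a * (a + 1) / 2) * emoment 2 F\<^sub>\<Lambda>"
    using powr_mixture_second_order[OF L L1 _ a v0 v_pos] a unfolding R3_def G_def by simp
  then have l3: "(\<lambda>n. ennreal (R3 n) * ennreal ((v n / s n)\<^sup>2))
      \<longlonglongrightarrow> ennreal (a * (a + 1) / 2) * emoment 2 F\<^sub>\<Lambda> * ennreal (\<mu>\<^sup>2)"
    by (rule tendsto_mult_ennreal) (use \<mu> tendsto_power[OF vs, of 2] in auto)
  have split: "ennreal (R1 n) + (ennreal (R2 n) * ennreal ((u n / s n)\<^sup>2) + ennreal (R3 n) * ennreal ((v n / s n)\<^sup>2))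
      = ennreal ((LS_transform F (s n) - 1 + \<mu> * s n) / (s n)\<^sup>2)" for n
  proof -
    have "R2 n * (u n / s n)\<^sup>2 = (u n - v n) / (s n)\<^sup>2" "R3 n * (v n / s n)\<^sup>2 = (G (v n) - 1 + v n) / (s n)\<^sup>2"
      using u_pos[of n] v_pos[of n] by (auto simp: R2_def R3_def power_divide)
    then have "R1 n + (R2 n * (u n / s n)\<^sup>2 + R3 n * (v n / s n)\<^sup>2)
        = (LS_transform F (s n) - 1 + \<mu> * s n) / (s n)\<^sup>2"
      by (simp add: R1_def LSG add_divide_distrib[symmetric])
    then show ?thesis using R[of n] by (simp add: ennreal_mult[symmetric] ennreal_plus[symmetric] del: ennreal_plus)
  qed
  have half: "ennreal (1 / 2) * emoment 2 F = ennreal (m2 / 2)"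
    unfolding m2(1) by (subst ennreal_mult[symmetric]) (use m2 in auto)
  show "ennreal (m2 / 2) = ennreal (m2 / 2) * emean F\<^sub>T
      + (ennreal (1 / 2) * emean F\<^sub>B * ennreal (\<mu>\<^sup>2)
      + ennreal (a * (a + 1) / 2) * emoment 2 F\<^sub>\<Lambda> * ennreal (\<mu>\<^sup>2))"
    by (rule LIMSEQ_unique[OF LS_transform_second_order[OF F m \<mu>' s, unfolded half split[symmetric]]])
      (intro tendsto_add l1 l2 l3)
qed

text \<open>
  The second moment of a solution is finite and positive, which makes every term of the second order identity
  finite; solving it for the second moment gives the variance. The term with \<open>F\<^sub>\<Lambda>\<close> is strictly positive because
  \<open>F\<^sub>\<Lambda>\<close> has mean \<open>1 / a\<close>, and this forces the mean of \<open>F\<^sub>T\<close> below \<open>1\<close>.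
\<close>

lemma solution_imp_moments:
  assumes sol: "is_solution \<mu> a F\<^sub>T F\<^sub>B F\<^sub>\<Lambda> F"
  shows "emean F\<^sub>T < 1" "emean F\<^sub>\<Lambda> = ennreal (1 / a)" "emoment 2 F\<^sub>\<Lambda> < \<infinity>" "emean F\<^sub>B < \<infinity>"
    "var F = (a\<^sup>2 * var F\<^sub>\<Lambda> + a * (LINT l|F\<^sub>\<Lambda>. l\<^sup>2) + mean F\<^sub>B + mean F\<^sub>T) / (1 - mean F\<^sub>T) * \<mu>\<^sup>2"
proof -
  have \<mu>': "0 \<le> \<mu>" using \<mu> by simp
  have F: "nonneg_distribution F" and m: "emean F = ennreal \<mu>" and "evar F < \<infinity>"
    and eq: "\<And>s. 0 \<le> s \<Longrightarrow> LS_transform F s = equation_rhs \<mu> a F\<^sub>T F\<^sub>B F\<^sub>\<Lambda> F s"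
    using sol by (auto simp: is_solution_def solves_equation_def equation_rhs_def)
  then have "emoment 2 F < \<infinity>" using evar_finite_iff[OF F m \<mu>'] by simp
  then obtain m2 where m2: "emoment 2 F = ennreal m2" "0 \<le> m2"
    by (cases "emoment 2 F" rule: ennreal_cases) auto
  have "\<mu>\<^sup>2 \<le> m2" and varF: "var F = m2 - \<mu>\<^sup>2" using var_eq[OF F m \<mu>' m2] by auto
  then have m2_pos: "0 < m2" using \<mu> less_le_trans[of 0 "\<mu>\<^sup>2" m2] by simp
  note ids = solution_moment_identities[OF F m m2 eq]
  show L1: "emean F\<^sub>\<Lambda> = ennreal (1 / a)" by (rule ids(1))
  have "ennreal (m2 / 2) * emean F\<^sub>T + (ennreal (1 / 2) * emean F\<^sub>B * ennreal (\<mu>\<^sup>2)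
      + ennreal (a * (a + 1) / 2) * emoment 2 F\<^sub>\<Lambda> * ennreal (\<mu>\<^sup>2)) < \<infinity>"
    \<comment> \<open>The sum equals half the second moment of \<open>F\<close>.\<close>
    by (subst ids(2)[symmetric]) simp_all
  then have fin: "emean F\<^sub>T < \<infinity>" "emean F\<^sub>B < \<infinity>" "emoment 2 F\<^sub>\<Lambda> < \<infinity>"
    using m2_pos a \<mu> by (auto simp: ennreal_mult_less_top)
  have finE: "\<exists>r. x = ennreal r \<and> 0 \<le> r" if "x < \<infinity>" for x
    using that by (cases x rule: ennreal_cases) auto
  obtain t where t: "emean F\<^sub>T = ennreal t" "0 \<le> t" using finE[OF fin(1)] by blast
  obtain b where b: "emean F\<^sub>B = ennreal b" "0 \<le> b" using finE[OF fin(2)] by blast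
  obtain l2 where l2: "emoment 2 F\<^sub>\<Lambda> = ennreal l2" "0 \<le> l2" using finE[OF fin(3)] by blast
  have L1': "0 \<le> 1 / a" using a by simp
  have varL: "var F\<^sub>\<Lambda> = l2 - 1 / a\<^sup>2" "1 / a\<^sup>2 \<le> l2"
    using var_eq[OF L L1 L1' l2] by (auto simp: power_divide)
  have l2_pos: "0 < l2" using varL(2) a less_le_trans[of 0 "1 / a\<^sup>2" l2] by simp
  have prod: "ennreal x * ennreal y * ennreal z = ennreal (x * y * z)" if "0 \<le> x" "0 \<le> y" "0 \<le> z" for x y z
    using that by (simp add: ennreal_mult)
  have "ennreal (1 / 2) * emean F\<^sub>B * ennreal (\<mu>\<^sup>2) = ennreal (1 / 2 * b * \<mu>\<^sup>2)"
    unfolding b(1) by (rule prod) (use b in auto)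
  moreover have "ennreal (a * (a + 1) / 2) * emoment 2 F\<^sub>\<Lambda> * ennreal (\<mu>\<^sup>2) = ennreal (a * (a + 1) / 2 * l2 * \<mu>\<^sup>2)"
    unfolding l2(1) by (rule prod) (use a l2 in auto)
  moreover have "ennreal (m2 / 2) * emean F\<^sub>T = ennreal (m2 / 2 * t)"
    unfolding t(1) by (rule ennreal_mult[symmetric]) (use m2 t in auto)
  ultimately have "ennreal (m2 / 2) = ennreal (m2 / 2 * t + (1 / 2 * b * \<mu>\<^sup>2 + a * (a + 1) / 2 * l2 * \<mu>\<^sup>2))"
    using ids(2) t b l2 a m2 by (subst ennreal_plus, force, force, subst ennreal_plus) auto
  then have id: "m2 / 2 = m2 / 2 * t + (1 / 2 * b * \<mu>\<^sup>2 + a * (a + 1) / 2 * l2 * \<mu>\<^sup>2)"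
    using t b l2 a m2 by (subst (asm) ennreal_inj) auto
  then have id': "m2 * (1 - t) = \<mu>\<^sup>2 * (b + a * (a + 1) * l2)" by (simp add: field_simps)
  have "0 < b + a * (a + 1) * l2" using a l2_pos b by (simp add: add_nonneg_pos)
  then have "0 < m2 * (1 - t)" unfolding id' using \<mu> by simp
  then have t1: "t < 1" using m2_pos by (simp add: zero_less_mult_iff)
  then show "emean F\<^sub>T < 1" using t by (simp add: ennreal_less_one_iff)
  show "emoment 2 F\<^sub>\<Lambda> < \<infinity>" "emean F\<^sub>B < \<infinity>" by fact+
  have means: "mean F\<^sub>T = t" "mean F\<^sub>B = b" "(LINT l|F\<^sub>\<Lambda>. l\<^sup>2) = l2"
    using emean_eq_ennreal(2)[OF T t] emean_eq_ennreal(2)[OF B b] second_moment_eq(2)[OF L l2]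
    by (auto simp: mean_def)
  have "a\<^sup>2 * var F\<^sub>\<Lambda> = a\<^sup>2 * l2 - 1" using a by (simp add: varL right_diff_distrib)
  then have "(a\<^sup>2 * var F\<^sub>\<Lambda> + a * l2 + b + t) * \<mu>\<^sup>2 = (a\<^sup>2 * l2 - 1 + a * l2 + b + t) * \<mu>\<^sup>2"
    by simp
  also have "\<dots> = \<mu>\<^sup>2 * (b + a * (a + 1) * l2) - \<mu>\<^sup>2 * (1 - t)"
    by (simp add: algebra_simps power2_eq_square)
  also have "\<dots> = (m2 - \<mu>\<^sup>2) * (1 - t)" unfolding id'[symmetric] by (simp add: algebra_simps)
  finally have "(a\<^sup>2 * var F\<^sub>\<Lambda> + a * l2 + b + t) * \<mu>\<^sup>2 = (m2 - \<mu>\<^sup>2) * (1 - t)" .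
  then show "var F = (a\<^sup>2 * var F\<^sub>\<Lambda> + a * (LINT l|F\<^sub>\<Lambda>. l\<^sup>2) + mean F\<^sub>B + mean F\<^sub>T) / (1 - mean F\<^sub>T) * \<mu>\<^sup>2"
    unfolding varF means using t1 by (simp add: eq_divide_eq)
qed

section \<open>Contraction, uniqueness and existence\<close>

context
  fixes t b l2 :: real
  assumes t: "emean F\<^sub>T = ennreal t" "0 \<le> t" "t < 1" and b: "emean F\<^sub>B = ennreal b" "0 \<le> b"
    and L1: "emean F\<^sub>\<Lambda> = ennreal (1 / a)" and l2: "emoment 2 F\<^sub>\<Lambda> = ennreal l2" "0 \<le> l2"
begin

text \<open>
  The maps \<open>sigma_B\<close> and \<open>y \<mapsto> \<integral> (1 + l * y) powr (- a)\<close> have Lipschitz constant \<open>1\<close>, the latter since the mean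
  of \<open>F\<^sub>\<Lambda>\<close> is \<open>1 / a\<close>. So the factor \<open>t\<close> comes from \<open>sigma\<close> alone.
\<close>

lemma equation_rhs_contraction:
  assumes F: "nonneg_distribution F" "emean F = ennreal \<mu>" and G: "nonneg_distribution G" "emean G = ennreal \<mu>"
    and diff: "\<And>s. 0 \<le> s \<Longrightarrow> \<bar>LS_transform F s - LS_transform G s\<bar> \<le> C * s\<^sup>2" and s: "0 \<le> s"
  shows "\<bar>equation_rhs \<mu> a F\<^sub>T F\<^sub>B F\<^sub>\<Lambda> F s - equation_rhs \<mu> a F\<^sub>T F\<^sub>B F\<^sub>\<Lambda> G s\<bar> \<le> C * t * s\<^sup>2"
proof -
  have \<mu>': "0 \<le> \<mu>" using \<mu> by simp
  have u: "0 \<le> sigma \<mu> F\<^sub>T F s" "0 \<le> sigma \<mu> F\<^sub>T G s"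
    using sigma_bounds[OF F \<mu>' T s] sigma_bounds[OF G \<mu>' T s] by auto
  have "\<bar>equation_rhs \<mu> a F\<^sub>T F\<^sub>B F\<^sub>\<Lambda> F s - equation_rhs \<mu> a F\<^sub>T F\<^sub>B F\<^sub>\<Lambda> G s\<bar>
      \<le> a * (1 / a) * \<bar>sigma_B F\<^sub>B (sigma \<mu> F\<^sub>T F s) - sigma_B F\<^sub>B (sigma \<mu> F\<^sub>T G s)\<bar>"
    unfolding equation_rhs_def
    by (rule powr_mixture_Lipschitz[OF L L1]) (use sigma_B_bounds[OF B] u a in auto)
  also have "\<dots> \<le> \<bar>sigma \<mu> F\<^sub>T F s - sigma \<mu> F\<^sub>T G s\<bar>"
    using sigma_B_Lipschitz[OF B u] a by simp
  also have "\<dots> \<le> C * t * s\<^sup>2"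
    by (rule sigma_diff_le[OF F \<mu>' G T t(1,2) diff s])
  finally show ?thesis .
qed

text \<open>
  Two distributions with equal means and finite second moments have transforms differing by \<open>O(s\<^sup>2)\<close>; for solutions the
  contraction can be applied to this bound arbitrarily often.
\<close>

lemma solution_unique:
  assumes "is_solution \<mu> a F\<^sub>T F\<^sub>B F\<^sub>\<Lambda> F" "is_solution \<mu> a F\<^sub>T F\<^sub>B F\<^sub>\<Lambda> G"
  shows "F = G"
proof -
  have \<mu>': "0 \<le> \<mu>" using \<mu> by simp
  have sol: "nonneg_distribution H" "emean H = ennreal \<mu>"
    "\<exists>h. 0 \<le> h \<and> (\<forall>s\<ge>0. LS_transform H s \<le> 1 - \<mu> * s + h / 2 * s\<^sup>2)"
    "\<And>s. 0 \<le> s \<Longrightarrow> LS_transform H s = equation_rhs \<mu> a F\<^sub>T F\<^sub>B F\<^sub>\<Lambda> H s"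
    if "is_solution \<mu> a F\<^sub>T F\<^sub>B F\<^sub>\<Lambda> H" for H
  proof -
    show H: "nonneg_distribution H" and m: "emean H = ennreal \<mu>"
      and "\<And>s. 0 \<le> s \<Longrightarrow> LS_transform H s = equation_rhs \<mu> a F\<^sub>T F\<^sub>B F\<^sub>\<Lambda> H s"
      using that by (auto simp: is_solution_def solves_equation_def equation_rhs_def)
    have "emoment 2 H < \<infinity>" using evar_finite_iff[OF H m \<mu>'] that by (simp add: is_solution_def)
    then obtain h where h: "emoment 2 H = ennreal h" "0 \<le> h"
      by (cases "emoment 2 H" rule: ennreal_cases) auto
    show "\<exists>h. 0 \<le> h \<and> (\<forall>s\<ge>0. LS_transform H s \<le> 1 - \<mu> * s + h / 2 * s\<^sup>2)"
      using LS_transform_le_quadratic[OF H m \<mu>' h] h by blast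
  qed
  note F = sol[OF assms(1)] and G = sol[OF assms(2)]
  from F(3) obtain f where f: "0 \<le> f" "\<And>s. 0 \<le> s \<Longrightarrow> LS_transform F s \<le> 1 - \<mu> * s + f / 2 * s\<^sup>2"
    by blast
  from G(3) obtain g where g: "0 \<le> g" "\<And>s. 0 \<le> s \<Longrightarrow> LS_transform G s \<le> 1 - \<mu> * s + g / 2 * s\<^sup>2"
    by blast
  define C where "C = (f + g) / 2"
  have iter: "\<bar>LS_transform F s - LS_transform G s\<bar> \<le> C * t ^ n * s\<^sup>2" if "0 \<le> s" for n s
    using that
  proof (induction n arbitrary: s)
    case 0
    have nn: "0 \<le> f / 2 * s\<^sup>2" "0 \<le> g / 2 * s\<^sup>2" using f(1) g(1) by auto
    have "C * t ^ 0 * s\<^sup>2 = f / 2 * s\<^sup>2 + g / 2 * s\<^sup>2" by (simp add: C_def field_simps)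
    then show ?case
      using f(2)[OF 0] g(2)[OF 0] LS_transform_ge_linear[OF F(1,2) \<mu>' 0]
        LS_transform_ge_linear[OF G(1,2) \<mu>' 0] nn by linarith
  next
    case (Suc n)
    from equation_rhs_contraction[OF F(1,2) G(1,2) Suc.IH Suc.prems]
    show ?case using F(4)[OF Suc.prems] G(4)[OF Suc.prems] by (simp add: mult_ac)
  qed
  show ?thesis
  proof (rule LS_transform_unique[OF F(1) G(1)])
    fix s :: real assume s: "0 \<le> s"
    have "(\<lambda>n. C * t ^ n * s\<^sup>2) \<longlonglongrightarrow> C * 0 * s\<^sup>2"
      using t by (intro tendsto_intros LIMSEQ_realpow_zero) auto
    then have "\<bar>LS_transform F s - LS_transform G s\<bar> \<le> C * 0 * s\<^sup>2"
      by (rule LIMSEQ_le_const) (use iter[OF s] in blast)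
    then show "LS_transform F s = LS_transform G s" by simp
  qed
qed


text \<open>
  The value that the second moment of a solution must have. It is the fixed point of the recursion for the
  second moments along the iteration, hence the quadratic upper bound it defines is preserved.
\<close>

definition second_moment_bound :: real where
  "second_moment_bound = \<mu>\<^sup>2 * (b + a * (a + 1) * l2) / (1 - t)"

definition admissible :: "real measure \<Rightarrow> bool" where
  "admissible F \<longleftrightarrow> nonneg_distribution F \<and> emean F = ennreal \<mu> \<and>
     (\<forall>s\<ge>0. LS_transform F s \<le> 1 - \<mu> * s + second_moment_bound / 2 * s\<^sup>2)"

text \<open>
  This makes the point mass at \<open>\<mu>\<close> an admissible starting point.
\<close>

lemma mu_squared_le_second_moment_bound: "\<mu>\<^sup>2 \<le> second_moment_bound"
proof -
  have "(1 / a)\<^sup>2 \<le> l2" using var_eq(2)[OF L L1 _ l2] a by simp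
  then have "a\<^sup>2 * (1 / a)\<^sup>2 \<le> a\<^sup>2 * l2" by (rule mult_left_mono) simp
  then have "1 \<le> a\<^sup>2 * l2" using a by (simp add: power_divide)
  moreover have "0 \<le> a * l2" using a l2 by simp
  ultimately have "1 - t \<le> b + a * (a + 1) * l2"
    using b t by (simp add: algebra_simps power2_eq_square)
  then have "1 \<le> (b + a * (a + 1) * l2) / (1 - t)" using t by (simp add: pos_le_divide_eq)
  then have "\<mu>\<^sup>2 * 1 \<le> \<mu>\<^sup>2 * ((b + a * (a + 1) * l2) / (1 - t))" by (rule mult_left_mono) simp
  then show ?thesis by (simp add: second_moment_bound_def)
qed

lemma second_moment_bound_fixed_point: "second_moment_bound * t + \<mu>\<^sup>2 * (b + a * (a + 1) * l2) = second_moment_bound"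
  using t by (simp add: second_moment_bound_def field_simps)

lemma equation_rhs_bounds:
  assumes F: "admissible F" and s: "0 \<le> s"
  shows "1 - \<mu> * s \<le> equation_rhs \<mu> a F\<^sub>T F\<^sub>B F\<^sub>\<Lambda> F s"
    "equation_rhs \<mu> a F\<^sub>T F\<^sub>B F\<^sub>\<Lambda> F s \<le> 1 - \<mu> * s + second_moment_bound / 2 * s\<^sup>2"
proof -
  have \<mu>': "0 \<le> \<mu>" and L1': "0 \<le> 1 / a" using \<mu> a by auto
  have nd: "nonneg_distribution F" "emean F = ennreal \<mu>"
    and q: "\<And>s. 0 \<le> s \<Longrightarrow> LS_transform F s \<le> 1 - \<mu> * s + second_moment_bound / 2 * s\<^sup>2"
    using F by (auto simp: admissible_def)
  define u where "u = sigma \<mu> F\<^sub>T F s"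
  define v where "v = sigma_B F\<^sub>B u"
  have u: "0 \<le> u" "u \<le> \<mu> * s" "\<mu> * s - second_moment_bound / 2 * s\<^sup>2 * t \<le> u"
    unfolding u_def using sigma_bounds[OF nd \<mu>' T s] sigma_ge[OF nd \<mu>' q T t(1,2) s] by auto
  have v: "0 \<le> v" "v \<le> u" "u - b / 2 * u\<^sup>2 \<le> v"
    unfolding v_def using sigma_B_bounds[OF B u(1)] sigma_B_ge[OF B b u(1)] by auto
  have r: "1 - v \<le> equation_rhs \<mu> a F\<^sub>T F\<^sub>B F\<^sub>\<Lambda> F s"
    "equation_rhs \<mu> a F\<^sub>T F\<^sub>B F\<^sub>\<Lambda> F s \<le> 1 - v + a * (a + 1) / 2 * l2 * v\<^sup>2"
    using powr_mixture_remainder[OF L L1 L1' v(1) a] powr_mixture_le_quadratic[OF L L1 L1' l2 v(1) a] a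
    by (auto simp: equation_rhs_def u_def v_def)
  show "1 - \<mu> * s \<le> equation_rhs \<mu> a F\<^sub>T F\<^sub>B F\<^sub>\<Lambda> F s" using r(1) v(2) u(2) by linarith
  have "u\<^sup>2 \<le> (\<mu> * s)\<^sup>2" "v\<^sup>2 \<le> (\<mu> * s)\<^sup>2" using u v by (auto intro!: power_mono)
  then have "b / 2 * u\<^sup>2 \<le> b / 2 * (\<mu> * s)\<^sup>2"
    "a * (a + 1) / 2 * l2 * v\<^sup>2 \<le> a * (a + 1) / 2 * l2 * (\<mu> * s)\<^sup>2"
    using b a l2 by (auto intro!: mult_left_mono)
  moreover have "second_moment_bound / 2 * s\<^sup>2 * t + (b / 2 * (\<mu> * s)\<^sup>2 + a * (a + 1) / 2 * l2 * (\<mu> * s)\<^sup>2)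
      = (second_moment_bound * t + \<mu>\<^sup>2 * (b + a * (a + 1) * l2)) / 2 * s\<^sup>2"
    by (simp add: power_mult_distrib field_simps)
  ultimately show "equation_rhs \<mu> a F\<^sub>T F\<^sub>B F\<^sub>\<Lambda> F s \<le> 1 - \<mu> * s + second_moment_bound / 2 * s\<^sup>2"
    using r(2) v(3) u(3) unfolding second_moment_bound_fixed_point by linarith
qed

lemma admissible_step:
  assumes F: "admissible F"
  shows "\<exists>G. admissible G \<and> (\<forall>s\<ge>0. LS_transform G s = equation_rhs \<mu> a F\<^sub>T F\<^sub>B F\<^sub>\<Lambda> F s)"
proof -
  have \<mu>': "0 \<le> \<mu>" and L1': "0 \<le> 1 / a" using \<mu> a by auto
  have nd: "nonneg_distribution F" "emean F = ennreal \<mu>"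
    and q: "\<And>s. 0 \<le> s \<Longrightarrow> LS_transform F s \<le> 1 - \<mu> * s + second_moment_bound / 2 * s\<^sup>2"
    using F by (auto simp: admissible_def)
  from equation_rhs_is_LS_transform[OF T B L L1 L1' a nd \<mu>' q]
  obtain G where G: "nonneg_distribution G"
    and eq: "\<And>s. 0 \<le> s \<Longrightarrow> LS_transform G s = equation_rhs \<mu> a F\<^sub>T F\<^sub>B F\<^sub>\<Lambda> F s"
    unfolding is_LS_transform_def by metis
  have "emean G = ennreal \<mu>"
    by (rule moments_of_quadratic_bounds(1)[OF G \<mu>']) (use equation_rhs_bounds[OF F] eq in auto)
  then show ?thesis using G eq equation_rhs_bounds[OF F] by (auto simp: admissible_def)
qed

text \<open>
  Both transforms lie in the same band of width \<open>O(s\<^sup>2)\<close> above \<open>1 - \<mu> * s\<close>.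
\<close>

lemma admissible_diff_le:
  assumes F: "admissible F" and G: "admissible G" and s: "0 \<le> s"
  shows "\<bar>LS_transform F s - LS_transform G s\<bar> \<le> second_moment_bound / 2 * s\<^sup>2"
proof -
  have \<mu>': "0 \<le> \<mu>" using \<mu> by simp
  have "1 - \<mu> * s \<le> LS_transform H s" "LS_transform H s \<le> 1 - \<mu> * s + second_moment_bound / 2 * s\<^sup>2"
    if "admissible H" for H
    using that s LS_transform_ge_linear[OF _ _ \<mu>' s] by (auto simp: admissible_def)
  from this[OF F] this[OF G] show ?thesis by linarith
qed

text \<open>
  The iterates started at the point mass at \<open>\<mu>\<close> form a Cauchy sequence at every \<open>s\<close>: \<open>F (n + k)\<close> and \<open>F n\<close> arise by \<open>n\<close> steps from
  the admissible \<open>F k\<close> and \<open>F 0\<close>. The limit is a transform by the continuity theorem, its moments are read off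
  from the band, and the contraction estimate shows that it solves the equation.
\<close>

lemma solution_exists: "\<exists>F. is_solution \<mu> a F\<^sub>T F\<^sub>B F\<^sub>\<Lambda> F"
proof -
  have \<mu>': "0 \<le> \<mu>" using \<mu> by simp
  have adm: "nonneg_distribution H" "emean H = ennreal \<mu>" if "admissible H" for H
    using that by (auto simp: admissible_def)
  obtain \<Phi> where \<Phi>: "\<And>F. admissible F \<Longrightarrow> admissible (\<Phi> F)"
    and \<Phi>_eq: "\<And>F s. admissible F \<Longrightarrow> 0 \<le> s \<Longrightarrow> LS_transform (\<Phi> F) s = equation_rhs \<mu> a F\<^sub>T F\<^sub>B F\<^sub>\<Lambda> F s"
    using admissible_step by metis
  define F where "F n = (\<Phi> ^^ n) (return borel \<mu>)" for n
  have F_Suc: "F (Suc n) = \<Phi> (F n)" for n by (simp add: F_def)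
  have F_adm: "admissible (F n)" for n
  proof (induction n)
    case 0
    have "exp (- (s * \<mu>)) \<le> 1 - \<mu> * s + second_moment_bound / 2 * s\<^sup>2" if "0 \<le> s" for s
    proof -
      have "exp (- (s * \<mu>)) \<le> 1 - s * \<mu> + (s * \<mu>)\<^sup>2 / 2"
        by (rule exp_neg_le_quadratic) (use that \<mu> in simp)
      also have "(s * \<mu>)\<^sup>2 / 2 \<le> second_moment_bound / 2 * s\<^sup>2"
        using mult_right_mono[OF mu_squared_le_second_moment_bound, of "s\<^sup>2"] by (simp add: power_mult_distrib mult.commute)
      finally show ?thesis by (simp add: mult.commute)
    qed
    then show ?case using point_mass[OF \<mu>'] by (simp add: F_def admissible_def)
  next
    case (Suc n)
    then show ?case unfolding F_Suc by (rule \<Phi>)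
  qed
  have close: "\<bar>LS_transform (F (n + k)) s - LS_transform (F n) s\<bar> \<le> second_moment_bound / 2 * t ^ n * s\<^sup>2"
    if "0 \<le> s" for n k s
    using that
  proof (induction n arbitrary: s)
    case 0
    then show ?case using admissible_diff_le[OF F_adm F_adm] by simp
  next
    case (Suc n)
    from equation_rhs_contraction[OF adm[OF F_adm] adm[OF F_adm] Suc.IH Suc.prems]
    show ?case using Suc.prems by (simp add: F_Suc \<Phi>_eq F_adm mult_ac)
  qed
  have rate: "(\<lambda>n. second_moment_bound / 2 * t ^ n * c) \<longlonglongrightarrow> 0" for c
    using t by (auto intro!: tendsto_eq_intros LIMSEQ_realpow_zero)
  have "convergent (\<lambda>n. LS_transform (F n) s)" if s: "0 \<le> s" for s
  proof (rule Cauchy_convergent, rule CauchyI')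
    fix e :: real assume "0 < e"
    with rate[of "s\<^sup>2"] have "\<forall>\<^sub>F n in sequentially. second_moment_bound / 2 * t ^ n * s\<^sup>2 < e"
      by (rule order_tendstoD)
    then obtain N where N: "\<And>n. N \<le> n \<Longrightarrow> second_moment_bound / 2 * t ^ n * s\<^sup>2 < e"
      by (auto simp: eventually_sequentially)
    have "dist (LS_transform (F m) s) (LS_transform (F n) s) < e" if "N \<le> m" "m < n" for m n
      using close[OF s, of m "n - m"] N[OF that(1)] that by (simp add: dist_real_def abs_minus_commute)
    then show "\<exists>N. \<forall>m\<ge>N. \<forall>n>m. dist (LS_transform (F m) s) (LS_transform (F n) s) < e" by blast
  qed
  then obtain g where g: "\<And>s. 0 \<le> s \<Longrightarrow> (\<lambda>n. LS_transform (F n) s) \<longlonglongrightarrow> g s"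
    unfolding convergent_def by metis
  have g_low: "1 - \<mu> * s \<le> g s" if "0 \<le> s" for s
    by (rule LIMSEQ_le_const[OF g[OF that]])
      (use LS_transform_ge_linear[OF adm[OF F_adm] \<mu>' that] in blast)
  have g_up: "g s \<le> 1 - \<mu> * s + second_moment_bound / 2 * s\<^sup>2" if "0 \<le> s" for s
    by (rule LIMSEQ_le_const2[OF g[OF that]]) (use F_adm that in \<open>auto simp: admissible_def\<close>)
  have g_le_1: "g s \<le> 1" if "0 \<le> s" for s
    by (rule LIMSEQ_le_const2[OF g[OF that]]) (use LS_transform_bounds(2)[OF adm(1)[OF F_adm] that] in blast)
  have "((\<lambda>s. 1 - g s) \<longlongrightarrow> 0) (at_right 0)"
    by (rule tendsto_0_of_linear_bound[of _ \<mu>]) (use g_low g_le_1 in \<open>auto simp: algebra_simps\<close>)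
  from tendsto_diff[OF tendsto_const[of 1] this] have "(g \<longlongrightarrow> 1) (at_right 0)" by simp
  then have "is_LS_transform g"
    by (intro is_LS_transform_limit[OF _ g]) (auto intro: is_LS_transformI[OF adm(1)[OF F_adm]])
  then obtain G where G: "nonneg_distribution G" and Gg: "\<And>s. 0 \<le> s \<Longrightarrow> g s = LS_transform G s"
    by (auto simp: is_LS_transform_def)
  have mom: "emean G = ennreal \<mu>" "emoment 2 G < \<infinity>"
    using moments_of_quadratic_bounds[OF G \<mu>', of second_moment_bound] g_low g_up Gg by auto
  have "LS_transform G s = equation_rhs \<mu> a F\<^sub>T F\<^sub>B F\<^sub>\<Lambda> G s" if s: "0 \<le> s" for s
  proof -
    have "\<bar>LS_transform G s - LS_transform (F n) s\<bar> \<le> second_moment_bound / 2 * t ^ n * s\<^sup>2" if s: "0 \<le> s" for n s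
    proof (rule LIMSEQ_le_const2)
      have "(\<lambda>k. LS_transform (F (n + k)) s) \<longlonglongrightarrow> LS_transform G s"
        using LIMSEQ_ignore_initial_segment[OF g[OF s], of n] by (simp add: Gg[OF s] add.commute)
      then show "(\<lambda>k. \<bar>LS_transform (F (n + k)) s - LS_transform (F n) s\<bar>)
          \<longlonglongrightarrow> \<bar>LS_transform G s - LS_transform (F n) s\<bar>"
        by (intro tendsto_intros)
    qed (use close[OF s] in blast)
    then have "\<bar>equation_rhs \<mu> a F\<^sub>T F\<^sub>B F\<^sub>\<Lambda> G s - equation_rhs \<mu> a F\<^sub>T F\<^sub>B F\<^sub>\<Lambda> (F n) s\<bar> \<le> second_moment_bound / 2 * t ^ n * t * s\<^sup>2" for n
      by (rule equation_rhs_contraction[OF G mom(1) adm[OF F_adm] _ s])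
    then have "\<bar>LS_transform (F (Suc n)) s - equation_rhs \<mu> a F\<^sub>T F\<^sub>B F\<^sub>\<Lambda> G s\<bar> \<le> second_moment_bound / 2 * t ^ n * (t * s\<^sup>2)" for n
      by (simp add: F_Suc \<Phi>_eq[OF F_adm s] abs_minus_commute mult.assoc)
    then have "(\<lambda>n. LS_transform (F (Suc n)) s - equation_rhs \<mu> a F\<^sub>T F\<^sub>B F\<^sub>\<Lambda> G s) \<longlonglongrightarrow> 0"
      by (intro Lim_null_comparison[OF _ rate[of "t * s\<^sup>2"]]) simp
    then have "(\<lambda>n. LS_transform (F (Suc n)) s) \<longlonglongrightarrow> equation_rhs \<mu> a F\<^sub>T F\<^sub>B F\<^sub>\<Lambda> G s"
      by (simp add: LIM_zero_iff)
    with LIMSEQ_Suc[OF g[OF s]] show ?thesis by (simp add: Gg[OF s] LIMSEQ_unique)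
  qed
  then have "is_solution \<mu> a F\<^sub>T F\<^sub>B F\<^sub>\<Lambda> G"
    using G mom evar_finite_iff[OF G mom(1) \<mu>'] by (simp add: is_solution_def solves_equation_def equation_rhs_def)
  then show ?thesis ..
qed

end
end

theorem theorem3:
  fixes \<mu> a :: real and F\<^sub>T F\<^sub>B F\<^sub>\<Lambda> :: "real measure"
  assumes "0 < \<mu>" and "0 < a"
    and "nonneg_distribution F\<^sub>T" and "nonneg_distribution F\<^sub>B" and "nonneg_distribution F\<^sub>\<Lambda>"
  shows "((0 \<le> emean F\<^sub>T \<and> emean F\<^sub>T < 1 \<and> emean F\<^sub>\<Lambda> = ennreal (1 / a) \<and>
      emoment 2 F\<^sub>\<Lambda> < \<infinity> \<and> 0 \<le> emean F\<^sub>B \<and> emean F\<^sub>B < \<infinity>)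
    \<longleftrightarrow> (\<exists>!F. is_solution \<mu> a F\<^sub>T F\<^sub>B F\<^sub>\<Lambda> F)) \<and>
    ((\<exists>!F. is_solution \<mu> a F\<^sub>T F\<^sub>B F\<^sub>\<Lambda> F) \<longrightarrow>
      (\<forall>F. is_solution \<mu> a F\<^sub>T F\<^sub>B F\<^sub>\<Lambda> F \<longrightarrow>
        var F = (a\<^sup>2 * var F\<^sub>\<Lambda> + a * (LINT l|F\<^sub>\<Lambda>. l\<^sup>2) + mean F\<^sub>B + mean F\<^sub>T)
          / (1 - mean F\<^sub>T) * \<mu>\<^sup>2))"
proof -
  note moments = solution_imp_moments[OF assms]
  have "\<exists>!F. is_solution \<mu> a F\<^sub>T F\<^sub>B F\<^sub>\<Lambda> F"
    if "emean F\<^sub>T < 1" and L1: "emean F\<^sub>\<Lambda> = ennreal (1 / a)"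
      and "emoment 2 F\<^sub>\<Lambda> < \<infinity>" and "emean F\<^sub>B < \<infinity>"
  proof -
    have finE: "\<exists>r. x = ennreal r \<and> 0 \<le> r" if "x < \<infinity>" for x
      using that by (cases x rule: ennreal_cases) auto
    have "emean F\<^sub>T < \<infinity>" by (rule less_trans[OF \<open>emean F\<^sub>T < 1\<close>]) simp
    from finE[OF this] obtain t where t: "emean F\<^sub>T = ennreal t" "0 \<le> t" by blast
    then have "t < 1" using \<open>emean F\<^sub>T < 1\<close> by (simp add: ennreal_less_one_iff)
    obtain b where b: "emean F\<^sub>B = ennreal b" "0 \<le> b" using finE[OF \<open>emean F\<^sub>B < \<infinity>\<close>] by blast
    obtain l2 where l2: "emoment 2 F\<^sub>\<Lambda> = ennreal l2" "0 \<le> l2"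
      using finE[OF \<open>emoment 2 F\<^sub>\<Lambda> < \<infinity>\<close>] by blast
    show ?thesis
      using solution_exists[OF assms t \<open>t < 1\<close> b L1 l2] solution_unique[OF assms t \<open>t < 1\<close> b L1 l2] by blast
  qed
  then show ?thesis using moments by (auto simp del: One_nat_def)
qed
end
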